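(* Let $\mathbb{G}$ be a Carnot group of homogeneous dimension $\mathcal{Q}$ and let $E\subseteq\mathbb{G}$ be a compact set with $\mathrm{diam}(E)>0$ such that: ($\alpha$) there is $\eta_1\in\mathbb{N}$ such that $\eta_1^{-1}r^{\mathcal{Q}-1}\le\mathcal{H}^{\mathcal{Q}-1}(E\cap B(x,r))\le\eta_1r^{\mathcal{Q}-1}$ for every $0<r<\mathrm{diam}(E)$ and every $x\in E$; ($\beta$) the functions $x\mapsto d_{x,r}(\mathcal{H}^{\mathcal{Q}-1}\llcorner E,\mathfrak{M})$ converge uniformly to $0$ on $E$ as $r\to0$. Then there is $\eta_2\in\mathbb{N}$ such that for $\mathcal{H}^{\mathcal{Q}-1}$-almost every $x\in E$ and every sufficiently small $\rho>0$ there is a plane $W_{x,\rho}\in Gr(\mathcal{Q}-1)$ with $$\mathcal{H}^{\mathcal{Q}-1}\big(P_{W_{x,\rho}}(E\cap B(x,\rho))\big)\ge\eta_2^{-1}\rho^{\mathcal{Q}-1}.$$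
   Context: Carnot group: $\mathbb{G}$ is a connected, simply connected Lie group whose Lie algebra has a stratification $V_1\oplus\dots\oplus V_s$ and is generated by $V_1$. Via exponential coordinates $\mathbb{G}=(\mathbb{R}^n,* )$ with $*$ given by the Baker–Campbell–Hausdorff formula, the layers $V_i$ being mutually orthogonal in $\mathbb{R}^n$; $x_i=\pi_i(x)$ is the component of $x$ in $V_i$. Dilations: $\delta_\lambda(x)=(\lambda x_1,\dots,\lambda^sx_s)$. Homogeneous dimension: $\mathcal{Q}=\sum_i i\dim V_i$. Metric: $d(x,y)=\|x^{-1}*y\|$ with $\|g\|=\max\{\epsilon_1|g_1|,\epsilon_2|g_2|^{1/2},\dots,\epsilon_s|g_s|^{1/s}\}$, where $\epsilon_1=1$ and $\epsilon_2,\dots,\epsilon_s>0$ are fixed constants depending only on $\mathbb{G}$, small enough that $d$ is a left-invariant homogeneous distance. $B(x,r)$ is the open $d$-ball. $\mathcal{H}^{\mathcal{Q}-1}$ and $\mathcal{S}^{\mathcal{Q}-1}$ are the Hausdorff and spherical Hausdorff measures with respect to $d$. $Gr(\mathcal{Q}-1)$: the $\delta_\lambda$-invariant Lie subgroups of Hausdorff dimension $\mathcal{Q}-1$, i.e. $V=\mathscr{V}\oplus V_2\oplus\dots\oplus V_s$ with $\mathscr{V}\subset V_1$ a hyperplane; $\mathfrak{n}(V)\in V_1$ is a unit vector orthogonal to $V$ and $\mathfrak{N}(V)=\mathbb{R}\,\mathfrak{n}(V)$. Every $g\in\mathbb{G}$ is uniquely $g=P_Vg*P_{\mathfrak{N}(V)}g$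 with $P_Vg\in V$ and $P_{\mathfrak{N}(V)}g\in\mathfrak{N}(V)$; $P_V$ is the splitting projection on $V$. Distance from flat measures: for a Radon measure $\phi$, $x\in\mathbb{G}$, $r>0$, $$d_{x,r}(\phi,\mathfrak{M})=\inf_{\Theta>0,\,V\in Gr(\mathcal{Q}-1)}\frac{F_{x,r}(\phi,\Theta\,\mathcal{S}^{\mathcal{Q}-1}\llcorner xV)}{r^{\mathcal{Q}}},\qquad F_{x,r}(\phi,\psi)=\sup\Big|\int f\,d\phi-\int f\,d\psi\Big|,$$ where the supremum runs over the non-negative $1$-Lipschitz functions $f$ with support in $\overline{B(x,r)}$. *)

theory Defs
  imports "HOL-Analysis.Analysis"
begin

section \<open>Carnot groups in exponential coordinates\<close>

text \<open>
  The underlying space is a Euclidean space; \<open>lie\<close> is the Lie bracket, \<open>gop\<close> the group law, and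
  \<open>layer 1, \<dots>, layer step\<close> is the stratification (values of \<open>layer\<close> and \<open>eps\<close> at other indices
  are irrelevant).  Group inverse and unit are \<open>- x\<close> and \<open>0\<close>.
\<close>

record 'a carnot =
  step :: nat
  layer :: "nat \<Rightarrow> 'a set"
  lie :: "'a \<Rightarrow> 'a \<Rightarrow> 'a"
  gop :: "'a \<Rightarrow> 'a \<Rightarrow> 'a"
  eps :: "nat \<Rightarrow> real"

text \<open>Right-nested iterated brackets \<open>[x\<^sub>1,[x\<^sub>2,\<dots>[x\<^sub>k\<^sub>-\<^sub>1,x\<^sub>k]\<dots>]]\<close>.\<close>

fun nested_bracket :: "('a \<Rightarrow> 'a \<Rightarrow> 'a::zero) \<Rightarrow> 'a list \<Rightarrow> 'a" where
  "nested_bracket br [] = 0"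
| "nested_bracket br [x] = x"
| "nested_bracket br (x # y # xs) = br x (nested_bracket br (y # xs))"

text \<open>
  Dynkin's form of the Baker--Campbell--Hausdorff series:
  the sum over all nonempty lists \<open>(p\<^sub>1,q\<^sub>1), \<dots>, (p\<^sub>k,q\<^sub>k)\<close> with \<open>p\<^sub>i + q\<^sub>i > 0\<close> of
  \<open>(-1)\<^sup>k\<^sup>-\<^sup>1/k \<cdot> [x\<^sup>p\<^sup>1 y\<^sup>q\<^sup>1 \<dots> x\<^sup>p\<^sup>k y\<^sup>q\<^sup>k] / (\<Sum>(p\<^sub>i+q\<^sub>i) \<cdot> \<Prod> p\<^sub>i! q\<^sub>i!)\<close>.
  In a Lie algebra that is nilpotent of step \<open>s\<close> all terms of degree above \<open>s\<close> vanish, so the sum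
  is cut off there; the index set is then finite.
\<close>

definition dynkin_degree :: "(nat \<times> nat) list \<Rightarrow> nat" where
  "dynkin_degree ps = (\<Sum>(p, q)\<leftarrow>ps. p + q)"

definition dynkin_index :: "nat \<Rightarrow> (nat \<times> nat) list set" where
  "dynkin_index s = {ps. ps \<noteq> [] \<and> (\<forall>(p, q)\<in>set ps. 0 < p + q) \<and> dynkin_degree ps \<le> s}"

definition dynkin_coeff :: "(nat \<times> nat) list \<Rightarrow> real" where
  "dynkin_coeff ps = (-1) ^ (length ps - 1) /
     (real (length ps) * real (dynkin_degree ps) * (\<Prod>(p, q)\<leftarrow>ps. fact p * fact q))"

definition bch :: "nat \<Rightarrow> ('a \<Rightarrow> 'a \<Rightarrow> 'a) \<Rightarrow> 'a \<Rightarrow> 'a \<Rightarrow> 'a::real_vector" where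
  "bch s br x y = (\<Sum>ps\<in>dynkin_index s. dynkin_coeff ps *\<^sub>R
     nested_bracket br (concat (map (\<lambda>(p, q). replicate p x @ replicate q y) ps)))"

definition component :: "('a::euclidean_space) carnot \<Rightarrow> nat \<Rightarrow> 'a \<Rightarrow> 'a" where
  "component G i x = (THE v. v \<in> layer G i \<and> (\<forall>w\<in>layer G i. orthogonal (x - v) w))"

definition dilation :: "('a::euclidean_space) carnot \<Rightarrow> real \<Rightarrow> 'a \<Rightarrow> 'a" where
  "dilation G l x = (\<Sum>i = 1..step G. l ^ i *\<^sub>R component G i x)"

definition hom_norm :: "('a::euclidean_space) carnot \<Rightarrow> 'a \<Rightarrow> real" where
  "hom_norm G g = Max ((\<lambda>i. eps G i * root i (norm (component G i g))) ` {1..step G})"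

definition hom_dist :: "('a::euclidean_space) carnot \<Rightarrow> 'a \<Rightarrow> 'a \<Rightarrow> real" where
  "hom_dist G x y = hom_norm G (gop G (- x) y)"

definition lie_algebra :: "('a::real_normed_vector \<Rightarrow> 'a \<Rightarrow> 'a) \<Rightarrow> bool" where
  "lie_algebra br \<longleftrightarrow>
     bilinear br \<and> (\<forall>x. br x x = 0) \<and>
     (\<forall>x y z. br x (br y z) + br y (br z x) + br z (br x y) = 0)"

definition stratification ::
    "nat \<Rightarrow> (nat \<Rightarrow> 'a set) \<Rightarrow> ('a \<Rightarrow> 'a \<Rightarrow> 'a::euclidean_space) \<Rightarrow> bool" where
  "stratification s V br \<longleftrightarrow>
     1 \<le> s \<and> V s \<noteq> {0} \<and> (\<forall>i\<in>{1..s}. subspace (V i)) \<and>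
     (\<forall>i\<in>{1..s}. \<forall>j\<in>{1..s}. i \<noteq> j \<longrightarrow> (\<forall>v\<in>V i. \<forall>w\<in>V j. orthogonal v w)) \<and>
     span (\<Union>i\<in>{1..s}. V i) = UNIV \<and>
     (\<forall>i\<in>{1..<s}. V (Suc i) = span {br v w | v w. v \<in> V 1 \<and> w \<in> V i}) \<and>
     (\<forall>v\<in>V 1. \<forall>w\<in>V s. br v w = 0)"

definition left_invariant_homogeneous_distance :: "('a::euclidean_space) carnot \<Rightarrow> bool" where
  "left_invariant_homogeneous_distance G \<longleftrightarrow>
     Metric_space UNIV (hom_dist G) \<and>
     (\<forall>z x y. hom_dist G (gop G z x) (gop G z y) = hom_dist G x y) \<and>
     (\<forall>l>0. \<forall>x y. hom_dist G (dilation G l x) (dilation G l y) = l * hom_dist G x y)"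

text \<open>
  For the BCH product \<open>group (gop G) 0 uminus\<close> follows from the Lie algebra axioms; it is
  listed as part of the structure of a Lie group.  The last three conditions say that
  the constants \<open>eps\<close> are admissible.
\<close>

definition carnot_group :: "('a::euclidean_space) carnot \<Rightarrow> bool" where
  "carnot_group G \<longleftrightarrow>
     lie_algebra (lie G) \<and>
     stratification (step G) (layer G) (lie G) \<and>
     group (gop G) 0 uminus \<and>
     (\<forall>x y. gop G x y = bch (step G) (lie G) x y) \<and>
     eps G 1 = 1 \<and> (\<forall>i\<in>{1..step G}. 0 < eps G i) \<and>
     left_invariant_homogeneous_distance G"

definition hom_dim :: "('a::euclidean_space) carnot \<Rightarrow> nat" where
  "hom_dim G = (\<Sum>i = 1..step G. i * dim (layer G i))"


section \<open>Balls, diameter, Hausdorff and spherical Hausdorff measures\<close>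

definition hball :: "('a::euclidean_space) carnot \<Rightarrow> 'a \<Rightarrow> real \<Rightarrow> 'a set" where
  "hball G = Metric_space.mball UNIV (hom_dist G)"

definition hcball :: "('a::euclidean_space) carnot \<Rightarrow> 'a \<Rightarrow> real \<Rightarrow> 'a set" where
  "hcball G = Metric_space.mcball UNIV (hom_dist G)"

definition hdiam :: "('a::euclidean_space) carnot \<Rightarrow> 'a set \<Rightarrow> ennreal" where
  "hdiam G A = (SUP x\<in>A. SUP y\<in>A. ennreal (hom_dist G x y))"

text \<open>
  Coverings are indexed by arbitrary subsets of \<open>nat\<close>, so finite coverings are included
  also for exponent \<open>0\<close>, where every member of the covering costs \<open>1\<close>.  The normalisation of
  the Hausdorff measure is \<open>(diam/2)\<^sup>m\<close>, matching \<open>r\<^sup>m\<close> for balls in the spherical measure.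
\<close>

definition hausdorff_outer :: "('a::euclidean_space) carnot \<Rightarrow> nat \<Rightarrow> 'a set \<Rightarrow> ennreal" where
  "hausdorff_outer G m A =
     (SUP \<delta>\<in>{0<..}. INF (I, C)\<in>{(I :: nat set, C).
         (\<forall>i\<in>I. hdiam G (C i) \<le> ennreal \<delta>) \<and> A \<subseteq> (\<Union>i\<in>I. C i)}.
       (\<Sum>i. if i \<in> I then (hdiam G (C i) / 2) ^ m else 0))"

definition spherical_outer :: "('a::euclidean_space) carnot \<Rightarrow> nat \<Rightarrow> 'a set \<Rightarrow> ennreal" where
  "spherical_outer G m A =
     (SUP \<delta>\<in>{0<..}. INF (I, c, \<rho>)\<in>{(I :: nat set, c, \<rho>).
         (\<forall>i\<in>I. 0 < \<rho> i \<and> \<rho> i \<le> \<delta>) \<and> A \<subseteq> (\<Union>i\<in>I. hcball G (c i) (\<rho> i))}.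
       (\<Sum>i. if i \<in> I then ennreal (\<rho> i ^ m) else 0))"

text \<open>
  Both are metric outer measures for \<open>hom_dist G\<close>, which induces the Euclidean topology, hence
  countably additive on the Borel sets.
\<close>

definition hausdorff_measure :: "('a::euclidean_space) carnot \<Rightarrow> nat \<Rightarrow> 'a measure" where
  "hausdorff_measure G m = measure_of UNIV (sets borel) (hausdorff_outer G m)"

definition spherical_measure :: "('a::euclidean_space) carnot \<Rightarrow> nat \<Rightarrow> 'a measure" where
  "spherical_measure G m = measure_of UNIV (sets borel) (spherical_outer G m)"

definition measure_restriction :: "'a measure \<Rightarrow> 'a set \<Rightarrow> 'a measure" where
  "measure_restriction M A = density M (indicator A)"


section \<open>Vertical hyperplanes and splitting projections\<close>

text \<open>\<open>Gr G\<close> is the set of homogeneous subgroups of codimension one, i.e. of Hausdorff dimension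
  \<open>hom_dim G - 1\<close>.\<close>

definition Gr :: "('a::euclidean_space) carnot \<Rightarrow> 'a set set" where
  "Gr G = {V. \<exists>W. subspace W \<and> W \<subseteq> layer G 1 \<and> dim W + 1 = dim (layer G 1) \<and>
             V = span (W \<union> (\<Union>i\<in>{2..step G}. layer G i))}"

definition plane_normal :: "('a::euclidean_space) carnot \<Rightarrow> 'a set \<Rightarrow> 'a" where
  "plane_normal G V = (SOME n. n \<in> layer G 1 \<and> norm n = 1 \<and> (\<forall>v\<in>V. orthogonal n v))"

definition normal_line :: "('a::euclidean_space) carnot \<Rightarrow> 'a set \<Rightarrow> 'a set" where
  "normal_line G V = span {plane_normal G V}"

definition splitting_projection :: "('a::euclidean_space) carnot \<Rightarrow> 'a set \<Rightarrow> 'a \<Rightarrow> 'a" where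
  "splitting_projection G V g = (THE p. p \<in> V \<and> (\<exists>q\<in>normal_line G V. g = gop G p q))"


section \<open>Distance from flat measures\<close>

definition test_functions ::
    "('a::euclidean_space) carnot \<Rightarrow> 'a \<Rightarrow> real \<Rightarrow> ('a \<Rightarrow> real) set" where
  "test_functions G x r = {f. (\<forall>y. 0 \<le> f y) \<and> (\<forall>y z. \<bar>f y - f z\<bar> \<le> hom_dist G y z) \<and>
                              closure {y. f y \<noteq> 0} \<subseteq> closure (hball G x r)}"

definition F_dist ::
    "('a::euclidean_space) carnot \<Rightarrow> 'a \<Rightarrow> real \<Rightarrow> 'a measure \<Rightarrow> 'a measure \<Rightarrow> ennreal" where
  "F_dist G x r \<phi> \<psi> =
     (SUP f\<in>test_functions G x r. ennreal \<bar>integral\<^sup>L \<phi> f - integral\<^sup>L \<psi> f\<bar>)"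

definition flat_distance ::
    "('a::euclidean_space) carnot \<Rightarrow> 'a \<Rightarrow> real \<Rightarrow> 'a measure \<Rightarrow> ennreal" where
  "flat_distance G x r \<phi> =
     (INF (\<Theta>, V)\<in>{0<..} \<times> Gr G.
        F_dist G x r \<phi> (scale_measure (ennreal \<Theta>)
          (measure_restriction (spherical_measure G (hom_dim G - 1)) (gop G x ` V)))
        / ennreal (r ^ hom_dim G))"

end

theory Submission
  imports Defs
begin

text \<open>
  The bound holds at every \<open>x \<in> E\<close>, with \<open>W\<close> the plane that approximates \<open>E\<close> at scale \<open>\<rho>\<close> around \<open>x\<close>.
  Testing the flat distance against bumps \<open>max 0 (t - d c y)\<close> and using Ahlfors regularity, one
  finds at every point \<open>p \<in> E\<close> and every small scale a plane \<open>V\<close> such that \<open>E\<close> and \<open>pV\<close> are close to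
  each other in both directions (bilateral flatness).  For a horizontal unit vector \<open>n\<close> the map
  \<open>g \<mapsto> \<langle>g, n\<rangle>\<close> is a 1-Lipschitz homomorphism whose kernel is a vertical plane, so tilting of planes and
  sides of planes can be read off these homomorphisms alone.

  Bilateral flatness forces the normals at comparable points and scales to be almost parallel; orienting
  them from scale \<open>\<rho>\<close> downwards gives a locally constant notion of the side of \<open>E\<close> on which a
  point off \<open>E\<close> lies.  A segment of a coset of the normal line \<open>\<real>n\<close> through a point of \<open>xW\<close> near \<open>x\<close>
  ends on different sides, hence meets \<open>E\<close>.  Therefore \<open>P\<^sub>W(E \<inter> B(x, \<rho>))\<close> contains the translate by \<open>x\<close> of
  \<open>(W \<inter> B(0, \<rho>/32)) * exp(-\<langle>x, n\<rangle> n)\<close>.  That set is a left translate of a conjugate of a ball of \<open>W\<close>,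
  whose Hausdorff measure is bounded below by a covering argument; the finiteness and positivity
  of the spherical measure on \<open>W\<close>, needed there, also come from the flat distance.
\<close>

section \<open>The Baker--Campbell--Hausdorff product\<close>

abbreviation bch_word :: "'a \<Rightarrow> 'a \<Rightarrow> (nat \<times> nat) list \<Rightarrow> 'a list" where
  "bch_word x y ps \<equiv> concat (map (\<lambda>(p, q). replicate p x @ replicate q y) ps)"

lemma length_bch_word: "length (bch_word x y ps) = dynkin_degree ps"
proof (induction ps)
  case (Cons a ps)
  then show ?case
    by (cases a) (simp add: dynkin_degree_def)
qed (simp add: dynkin_degree_def)

lemma set_bch_word: "set (bch_word x y ps) \<subseteq> {x, y}"
proof (induction ps)
  case (Cons a ps)
  then show ?case
    by (cases a) (auto simp del: set_concat)
qed simp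

lemma length_le_dynkin_degree:
  assumes "\<forall>(p, q)\<in>set ps. 0 < p + q"
  shows "length ps \<le> dynkin_degree ps"
  using assms by (induction ps) (auto simp: dynkin_degree_def)

lemma dynkin_entry_le:
  assumes "(p, q) \<in> set ps"
  shows "p + q \<le> dynkin_degree ps"
  using assms by (induction ps) (auto simp: dynkin_degree_def)

lemma finite_dynkin_index: "finite (dynkin_index s)"
proof -
  have "dynkin_index s \<subseteq> {ps. set ps \<subseteq> {..s} \<times> {..s} \<and> length ps \<le> s}"
  proof (clarsimp simp: dynkin_index_def, intro conjI subsetI)
    fix ps :: "(nat \<times> nat) list"
    assume *: "ps \<noteq> []" "\<forall>x\<in>set ps. case x of (p, q) \<Rightarrow> 0 < p \<or> 0 < q" "dynkin_degree ps \<le> s"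
    show "length ps \<le> s"
      using length_le_dynkin_degree[of ps] * by fastforce
    fix z assume "z \<in> set ps"
    then show "z \<in> {..s} \<times> {..s}"
      using dynkin_entry_le[of "fst z" "snd z" ps] * by (cases z) auto
  qed
  moreover have "finite {ps. set ps \<subseteq> {..s} \<times> {..s} \<and> length ps \<le> s}"
    by (rule finite_lists_length_le) simp
  ultimately show ?thesis
    by (rule finite_subset)
qed

lemma dynkin_index_degree_ge_2:
  assumes "ps \<in> dynkin_index s - {[(1, 0)], [(0, 1)]}"
  shows "2 \<le> dynkin_degree ps"
proof (rule ccontr)
  assume "\<not> 2 \<le> dynkin_degree ps"
  then have deg: "dynkin_degree ps \<le> 1" by simp
  have pos: "\<forall>(p, q)\<in>set ps. 0 < p + q" and ne: "ps \<noteq> []"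
    using assms by (auto simp: dynkin_index_def)
  have "length ps \<le> 1"
    using length_le_dynkin_degree[OF pos] deg by simp
  with ne obtain p q where ps: "ps = [(p, q)]"
    by (cases ps) auto
  have "p + q \<le> 1" "0 < p + q"
    using deg pos by (auto simp: ps dynkin_degree_def)
  then have "(p, q) = (1, 0) \<or> (p, q) = (0, 1)" by auto
  then show False
    using assms by (auto simp: ps)
qed

lemma bch_word_two_letters:
  assumes "ps \<in> dynkin_index s - {[(1, 0)], [(0, 1)]}"
  obtains a b l where "bch_word x y ps = a # b # l"
proof -
  have "2 \<le> length (bch_word x y ps)"
    using dynkin_index_degree_ge_2[OF assms] by (simp only: length_bch_word)
  then show thesis
    using that by (cases "bch_word x y ps" rule: remdups_adj.cases) auto
qed

text \<open>The two one-letter words contribute \<open>x\<close> and \<open>y\<close>. Every other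
  word has at least two letters, so its term is a genuine bracket.\<close>

lemma bch_split:
  assumes "1 \<le> s"
  shows "bch s br x y = x + y + (\<Sum>ps\<in>dynkin_index s - {[(1, 0)], [(0, 1)]}.
           dynkin_coeff ps *\<^sub>R nested_bracket br (bch_word x y ps))"
proof -
  have "{[(1, 0)], [(0, 1)]} \<subseteq> dynkin_index s"
    using assms by (auto simp: dynkin_index_def dynkin_degree_def)
  then show ?thesis
    unfolding bch_def
    by (subst sum.subset_diff[OF _ finite_dynkin_index, of "{[(1, 0)], [(0, 1)]}"])
       (auto simp: dynkin_coeff_def dynkin_degree_def)
qed

section \<open>Continuity of the product and its restriction to a line\<close>

lemma continuous_on_nested_bracket:
  fixes br :: "'a::euclidean_space \<Rightarrow> 'a \<Rightarrow> 'a"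
  assumes "bilinear br" "\<And>f. f \<in> set fs \<Longrightarrow> continuous_on UNIV f"
  shows "continuous_on UNIV (\<lambda>y::'b::topological_space. nested_bracket br (map (\<lambda>f. f y) fs))"
  using assms(2)
proof (induction fs rule: remdups_adj.induct)
  case (3 f g fs)
  interpret bounded_bilinear br
    using assms(1) bilinear_conv_bounded_bilinear by blast
  show ?case
    using 3 by (auto intro!: continuous_on simp del: list.map intro: 3)
       (force intro!: continuous_on)
qed auto

lemma continuous_on_bch:
  fixes br :: "'a::euclidean_space \<Rightarrow> 'a \<Rightarrow> 'a"
  assumes "bilinear br"
  shows "continuous_on UNIV (bch s br x)"
proof -
  have "bch_word x y ps = map (\<lambda>f. f y) (bch_word (\<lambda>_. x) (\<lambda>y. y) ps)" for y ps
    by (induction ps) auto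
  then have "continuous_on UNIV (\<lambda>y. nested_bracket br (bch_word x y ps))" for ps
    using continuous_on_nested_bracket[OF assms, of "bch_word (\<lambda>_. x) (\<lambda>y. y) ps"]
      set_bch_word[of "\<lambda>_. x" "\<lambda>y. y" ps]
    by (metis (no_types, lifting) continuous_on_const continuous_on_cong continuous_on_id insertE singletonD subsetD)
  then show ?thesis
    unfolding bch_def by (intro continuous_intros)
qed

lemma nested_bracket_range_scaleR:
  fixes u :: "'a::real_vector"
  assumes "\<And>a b. br (a *\<^sub>R u) (b *\<^sub>R u) = 0" "set l \<subseteq> range (\<lambda>a. a *\<^sub>R u)"
  shows "nested_bracket br l \<in> range (\<lambda>a. a *\<^sub>R u)"
  using assms
proof (induction br l rule: nested_bracket.induct)
  case 1
  have "(0::'a) = 0 *\<^sub>R u" by simp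
  then show ?case by (metis nested_bracket.simps(1) rangeI)
next
  case (2 br x)
  then show ?case by simp
next
  case (3 br x y l)
  then have "nested_bracket br (y # l) \<in> range (\<lambda>a. a *\<^sub>R u)" "x \<in> range (\<lambda>a. a *\<^sub>R u)"
    by auto
  then have "nested_bracket br (x # y # l) = 0"
    using 3(2) by force
  moreover have "(0::'a) = 0 *\<^sub>R u" by simp
  ultimately show ?case by (metis rangeI)
qed

text \<open>Brackets of multiples of \<open>u\<close> vanish, so only the linear part survives:
  lines through \<open>0\<close> are one-parameter subgroups.\<close>

lemma bch_scaleR:
  assumes "bilinear br" "br u u = 0" "1 \<le> s"
  shows "bch s br (a *\<^sub>R u) (b *\<^sub>R u) = (a + b) *\<^sub>R u"
proof -
  have br0: "br (a *\<^sub>R u) (b *\<^sub>R u) = 0" for a b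
    using assms by (simp add: bilinear_lmul bilinear_rmul)
  have "nested_bracket br (bch_word (a *\<^sub>R u) (b *\<^sub>R u) ps) = 0"
    if ps: "ps \<in> dynkin_index s - {[(1, 0)], [(0, 1)]}" for ps
  proof -
    obtain v w l where w: "bch_word (a *\<^sub>R u) (b *\<^sub>R u) ps = v # w # l"
      using bch_word_two_letters[OF ps] .
    then have sub: "set (v # w # l) \<subseteq> range (\<lambda>a. a *\<^sub>R u)"
      using set_bch_word[of "a *\<^sub>R u" "b *\<^sub>R u" ps] by auto
    then have "nested_bracket br (w # l) \<in> range (\<lambda>a. a *\<^sub>R u)"
      by (intro nested_bracket_range_scaleR br0) auto
    then show ?thesis
      using sub br0 by (auto simp: w)
  qed
  then show ?thesis
    by (simp add: bch_split[OF assms(3)] scaleR_add_left)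
qed


section \<open>Carnot groups\<close>

declare One_nat_def [simp del]

lemma root_1: "root 1 x = x"
  by (simp add: One_nat_def)

lemma continuous_on_Max_image:
  fixes f :: "'b \<Rightarrow> 'c::topological_space \<Rightarrow> real"
  assumes "finite I" "I \<noteq> {}" "\<And>i. i \<in> I \<Longrightarrow> continuous_on A (f i)"
  shows "continuous_on A (\<lambda>x. Max ((\<lambda>i. f i x) ` I))"
  using assms
proof (induction rule: finite_ne_induct)
  case (insert i I)
  then show ?case
    by (auto intro!: continuous_on_max)
qed auto

locale carnot_grp =
  fixes G :: "('a::euclidean_space) carnot"
  assumes carnot: "carnot_group G"
begin

abbreviation mult (infixl "\<odot>" 75) where "x \<odot> y \<equiv> gop G x y"
abbreviation d where "d \<equiv> hom_dist G"
abbreviation hnorm where "hnorm \<equiv> hom_norm G"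
abbreviation dil where "dil \<equiv> dilation G"
abbreviation comp where "comp \<equiv> component G"
abbreviation hor where "hor \<equiv> layer G 1"

lemma lie_bilinear: "bilinear (lie G)"
  and lie_self: "lie G x x = 0"
  and jacobi: "lie G x (lie G y z) + lie G y (lie G z x) + lie G z (lie G x y) = 0"
  and step_pos: "1 \<le> step G"
  and subspace_layer: "i \<in> {1..step G} \<Longrightarrow> subspace (layer G i)"
  and layer_orth: "\<lbrakk>i \<in> {1..step G}; j \<in> {1..step G}; i \<noteq> j; v \<in> layer G i; w \<in> layer G j\<rbrakk>
        \<Longrightarrow> v \<bullet> w = 0"
  and span_layers: "span (\<Union>i\<in>{1..step G}. layer G i) = UNIV"
  and layer_Suc: "i \<in> {1..<step G} \<Longrightarrow>
        layer G (Suc i) = span {lie G v w | v w. v \<in> hor \<and> w \<in> layer G i}"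
  and lie_top: "\<lbrakk>v \<in> hor; w \<in> layer G (step G)\<rbrakk> \<Longrightarrow> lie G v w = 0"
  and gop_bch: "x \<odot> y = bch (step G) (lie G) x y"
  and eps_1: "eps G 1 = 1"
  using carnot unfolding carnot_group_def stratification_def lie_algebra_def orthogonal_def
  by (blast | simp)+

sublocale group "gop G" 0 uminus
  using carnot unfolding carnot_group_def by blast

sublocale metr: Metric_space UNIV "hom_dist G"
  using carnot unfolding carnot_group_def left_invariant_homogeneous_distance_def by blast

lemma d_left: "d (z \<odot> x) (z \<odot> y) = d x y"
  using carnot unfolding carnot_group_def left_invariant_homogeneous_distance_def by blast

lemma d_dil: "0 < l \<Longrightarrow> d (dil l x) (dil l y) = l * d x y"
  using carnot unfolding carnot_group_def left_invariant_homogeneous_distance_def by blast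

lemmas d_tri = metr.triangle[OF UNIV_I UNIV_I UNIV_I]
lemmas d_comm = metr.commute

lemma hball_iff [simp]: "y \<in> hball G x r \<longleftrightarrow> d x y < r"
  by (simp add: hball_def)

lemma hcball_iff [simp]: "y \<in> hcball G x r \<longleftrightarrow> d x y \<le> r"
  by (simp add: hcball_def)

lemma d_0: "d 0 x = hnorm x"
  by (simp add: hom_dist_def)

lemma d_mult: "d x (x \<odot> y) = hnorm y"
  using d_left[of x 0 y] by (simp add: d_0)

lemma hnorm_minus: "hnorm (- x) = hnorm x"
  using d_left[of x 0 "- x"] by (simp add: d_0 d_comm)

lemma hnorm_mult: "hnorm (x \<odot> y) \<le> hnorm x + hnorm y"
  using d_tri[of 0 "x \<odot> y" x] by (simp add: d_0 d_mult)

lemma hnorm_nonneg [simp]: "0 \<le> hnorm x"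
  by (metis d_0 metr.nonneg)

lemma hor_subspace: "subspace hor"
  using subspace_layer step_pos by simp

section \<open>Orthogonal components and dilations\<close>

lemma component_eqI:
  assumes "i \<in> {1..step G}" "v \<in> layer G i" "\<And>w. w \<in> layer G i \<Longrightarrow> (x - v) \<bullet> w = 0"
  shows "comp i x = v"
  unfolding component_def
proof (rule the_equality)
  show "v \<in> layer G i \<and> (\<forall>w\<in>layer G i. orthogonal (x - v) w)"
    using assms by (simp add: orthogonal_def)
  fix u assume u: "u \<in> layer G i \<and> (\<forall>w\<in>layer G i. orthogonal (x - u) w)"
  have "v - u \<in> layer G i"
    using subspace_diff[OF subspace_layer] assms u by blast
  then have "(x - u) \<bullet> (v - u) = 0" "(x - v) \<bullet> (v - u) = 0"
    using assms u by (auto simp: orthogonal_def)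
  then have "(v - u) \<bullet> (v - u) = 0"
    by (simp add: inner_diff_left)
  then show "u = v" by simp
qed

lemma component_works:
  assumes "i \<in> {1..step G}"
  shows component_in: "comp i x \<in> layer G i"
    and component_orth: "w \<in> layer G i \<Longrightarrow> (x - comp i x) \<bullet> w = 0"
proof -
  obtain y z where yz: "y \<in> span (layer G i)" "\<And>w. w \<in> span (layer G i) \<Longrightarrow> orthogonal z w" "x = y + z"
    using orthogonal_subspace_decomp_exists[of "layer G i" x] by metis
  have "span (layer G i) = layer G i"
    using assms subspace_layer span_eq_iff by blast
  with yz have "comp i x = y"
    using assms by (intro component_eqI) (auto simp: orthogonal_def span_base)
  then show "comp i x \<in> layer G i" "w \<in> layer G i \<Longrightarrow> (x - comp i x) \<bullet> w = 0"
    using yz \<open>span (layer G i) = layer G i\<close> by (auto simp: orthogonal_def)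
qed

lemma component_linear:
  assumes "i \<in> {1..step G}"
  shows "linear (comp i)"
proof (rule linearI)
  show "comp i (x + y) = comp i x + comp i y" for x y
  proof (rule component_eqI[OF assms])
    show "comp i x + comp i y \<in> layer G i"
      using component_in assms subspace_add subspace_layer by blast
    show "(x + y - (comp i x + comp i y)) \<bullet> w = 0" if "w \<in> layer G i" for w
      using component_orth[OF assms that, of x] component_orth[OF assms that, of y]
      by (simp add: inner_simps)
  qed
  show "comp i (c *\<^sub>R x) = c *\<^sub>R comp i x" for c x
  proof (rule component_eqI[OF assms])
    show "c *\<^sub>R comp i x \<in> layer G i"
      using component_in assms subspace_scale subspace_layer by blast
    show "(c *\<^sub>R x - c *\<^sub>R comp i x) \<bullet> w = 0" if "w \<in> layer G i" for w
      using component_orth[OF assms that, of x] by (simp add: inner_simps)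
  qed
qed

lemma component_layer:
  assumes "i \<in> {1..step G}" "j \<in> {1..step G}" "x \<in> layer G j"
  shows "comp i x = (if i = j then x else 0)"
  using assms layer_orth subspace_0[OF subspace_layer[OF assms(1)]]
  by (intro component_eqI) auto

lemma sum_component: "(\<Sum>i = 1..step G. comp i x) = x"
proof -
  have lin: "linear (\<lambda>x. (\<Sum>i = 1..step G. comp i x))"
    by (intro linear_compose_sum ballI component_linear)
  have "x \<in> span (\<Union>i\<in>{1..step G}. layer G i)"
    by (simp add: span_layers)
  moreover have "(\<Sum>i = 1..step G. comp i y) = id y"
    if "y \<in> (\<Union>i\<in>{1..step G}. layer G i)" for y
    using that by (auto simp: component_layer)
  ultimately show ?thesis
    using linear_eq_on[OF lin linear_id] by fastforce
qed

lemma component_dil: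
  assumes "i \<in> {1..step G}"
  shows "comp i (dil l x) = l ^ i *\<^sub>R comp i x"
proof -
  interpret linear "comp i" by (rule component_linear[OF assms])
  have "comp i (dil l x) = (\<Sum>j = 1..step G. l ^ j *\<^sub>R comp i (comp j x))"
    by (simp add: dilation_def sum scale)
  also have "\<dots> = (\<Sum>j = 1..step G. if i = j then l ^ i *\<^sub>R comp i x else 0)"
  proof (rule sum.cong[OF refl])
    fix j assume j: "j \<in> {1..step G}"
    show "l ^ j *\<^sub>R comp i (comp j x) = (if i = j then l ^ i *\<^sub>R comp i x else 0)"
      using component_layer[OF assms j component_in[OF j]] by auto
  qed
  finally show ?thesis
    using assms by simp
qed

lemma dil_dil: "dil l (dil k x) = dil (l * k) x"
  using component_dil[of _ k x] unfolding dilation_def[of G l] dilation_def[of G "l * k"]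
  by (intro sum.cong) (auto simp: power_mult_distrib)

lemma dil_1: "dil 1 x = x"
  by (simp add: dilation_def sum_component)

lemma dil_0: "dil l 0 = 0"
  unfolding dilation_def using linear_0[OF component_linear] by (intro sum.neutral) auto

lemma hnorm_dil: "0 < l \<Longrightarrow> hnorm (dil l x) = l * hnorm x"
  using d_dil[of l 0 x] by (simp add: d_0 dil_0)

section \<open>Horizontal vectors as homomorphisms to the reals\<close>

lemma one_in: "1 \<in> {1..step G}"
  using step_pos by simp

lemma inner_hor:
  assumes "v \<in> hor"
  shows "x \<bullet> v = comp 1 x \<bullet> v"
  using component_orth[OF one_in assms, of x] by (simp add: inner_simps)

lemma inner_dil:
  assumes "v \<in> hor"
  shows "dil l x \<bullet> v = l * (x \<bullet> v)"
  unfolding inner_hor[OF assms, of "dil l x"] inner_hor[OF assms, of x]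
  by (simp add: component_dil[OF one_in])

lemma norm_comp_1_le: "norm (comp 1 x) \<le> hnorm x"
  unfolding hom_norm_def using one_in eps_1
  by (intro Max_ge) (auto simp: image_iff root_1 intro!: bexI[of _ 1])

lemma abs_inner_le:
  assumes "v \<in> hor"
  shows "\<bar>x \<bullet> v\<bar> \<le> hnorm x * norm v"
  using Cauchy_Schwarz_ineq2[of "comp 1 x" v] norm_comp_1_le[of x]
  by (metis inner_hor[OF assms] mult_right_mono norm_ge_zero order_trans)

lemma hnorm_hor:
  assumes "u \<in> hor"
  shows "hnorm u = norm u"
proof -
  have "eps G i * root i (norm (comp i u)) = (if i = 1 then norm u else 0)"
    if "i \<in> {1..step G}" for i
    using component_layer[OF that one_in assms] eps_1 that by (auto simp: root_1)
  then have "hnorm u = Max ((\<lambda>i. if i = 1 then norm u else 0) ` {1..step G})"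
    unfolding hom_norm_def by (intro arg_cong[of _ _ Max] image_cong refl)
  also have "\<dots> = norm u"
    using one_in by (intro Max_eqI) (auto simp: image_iff intro!: bexI[of _ 1])
  finally show ?thesis .
qed

text \<open>A bracket with a horizontal vector moves each layer one step up and kills the top one,
  so nothing lands in \<open>hor\<close>.\<close>

lemma lie_hor_any:
  assumes "v \<in> hor" "u \<in> hor"
  shows "lie G v x \<bullet> u = 0"
proof -
  have lin: "linear (lie G v)"
    using lie_bilinear by (simp add: bilinear_def)
  have layer: "lie G v w \<bullet> u = 0" if i: "i \<in> {1..step G}" and w: "w \<in> layer G i" for i w
  proof (cases "i = step G")
    case True
    then show ?thesis using lie_top assms w by simp
  next
    case False
    with i have i': "i \<in> {1..<step G}" by auto
    have "lie G v w \<in> layer G (Suc i)"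
      unfolding layer_Suc[OF i'] using assms w by (intro span_base) auto
    then show ?thesis
      using layer_orth[of "Suc i" 1] i' assms by auto
  qed
  have "x \<in> span (\<Union>i\<in>{1..step G}. layer G i)"
    by (simp add: span_layers)
  then show ?thesis
  proof (induction rule: span_induct_alt)
    case base
    then show ?case by (simp add: linear_0[OF lin])
  next
    case (step c w y)
    then show ?case using layer
      by (auto simp: linear_add[OF lin] linear_scale[OF lin] inner_simps)
  qed
qed

lemma lie_minus: "lie G y x = - lie G x y"
proof -
  have "lie G (x + y) (x + y) = lie G x x + lie G x y + (lie G y x + lie G y y)"
    by (simp only: bilinear_ladd[OF lie_bilinear] bilinear_radd[OF lie_bilinear] ac_simps)
  then have "lie G x y + lie G y x = 0"
    by (simp add: lie_self)
  then show ?thesis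
    by (metis minus_unique)
qed

lemma lie_jacobi': "lie G (lie G a b) z = lie G a (lie G b z) - lie G b (lie G a z)"
proof -
  have "lie G b (lie G z a) = - lie G b (lie G a z)"
    by (metis lie_minus bilinear_rneg[OF lie_bilinear])
  then show ?thesis
    using jacobi[of a b z] lie_minus[of "lie G a b" z] by (simp add: algebra_simps add_eq_0_iff)
qed

text \<open>Brackets have no horizontal component: by the Jacobi identity, bracketing with
  \<open>[V\<^sub>1, V\<^sub>i]\<close> reduces to bracketing with \<open>V\<^sub>1\<close> and with \<open>V\<^sub>i\<close>.\<close>

lemma lie_inner_hor:
  assumes "u \<in> hor"
  shows "lie G y x \<bullet> u = 0"
proof -
  \<comment> \<open>Induction on the layer of the first argument, with \<open>z\<close> arbitrary
    because the Jacobi identity replaces it by \<open>lie G a z\<close>.\<close>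
  have layer: "lie G w z \<bullet> u = 0" if "w \<in> layer G (Suc i)" "Suc i \<in> {1..step G}" for i w z
    using that
  proof (induction i arbitrary: w z)
    case 0
    then show ?case using lie_hor_any assms by (simp add: One_nat_def)
  next
    case (Suc i)
    have "w \<in> span {lie G v w | v w. v \<in> hor \<and> w \<in> layer G (Suc i)}"
      using layer_Suc[of "Suc i"] Suc.prems by simp
    then show ?case
    proof (induction rule: span_induct_alt)
      case base
      then show ?case by (simp add: bilinear_lzero[OF lie_bilinear])
    next
      case (step c e y)
      then obtain a b where "e = lie G a b" "a \<in> hor" "b \<in> layer G (Suc i)" by auto
      then have "lie G e z \<bullet> u = 0"
        using Suc.IH[of b "lie G a z"] lie_hor_any[of a u "lie G b z"] assms Suc.prems
        by (simp add: lie_jacobi' inner_simps)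
      then show ?case
        using step by (simp add: bilinear_ladd[OF lie_bilinear] bilinear_lmul[OF lie_bilinear]
            inner_simps)
    qed
  qed
  have "y \<in> span (\<Union>i\<in>{1..step G}. layer G i)"
    by (simp add: span_layers)
  then show ?thesis
  proof (induction rule: span_induct_alt)
    case base
    then show ?case by (simp add: bilinear_lzero[OF lie_bilinear])
  next
    case (step c w y)
    then obtain i where i: "i \<in> {1..step G}" "w \<in> layer G i" by auto
    then have "lie G w x \<bullet> u = 0" using layer[of w "i - 1" x] by simp
    then show ?case
      using step by (simp add: bilinear_ladd[OF lie_bilinear] bilinear_lmul[OF lie_bilinear]
          inner_simps)
  qed
qed

text \<open>Brackets are orthogonal to \<open>hor\<close>, so \<open>v\<close> sees only the linear
  part of the series. This additivity is the device by which planes, cosets and tilts are handled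
  from here on.\<close>

lemma inner_mult:
  assumes "v \<in> hor"
  shows "(x \<odot> y) \<bullet> v = x \<bullet> v + y \<bullet> v"
proof -
  have "nested_bracket (lie G) (bch_word x y ps) \<bullet> v = 0"
    if ps: "ps \<in> dynkin_index (step G) - {[(1, 0)], [(0, 1)]}" for ps
  proof -
    obtain a b l where "bch_word x y ps = a # b # l"
      using bch_word_two_letters[OF ps] .
    then show ?thesis
      using lie_inner_hor[OF assms] by simp
  qed
  then show ?thesis
    by (simp add: gop_bch bch_split[OF step_pos] inner_simps inner_sum_left)
qed

lemma mult_scaleR: "(a *\<^sub>R u) \<odot> (b *\<^sub>R u) = (a + b) *\<^sub>R u"
  by (simp add: gop_bch bch_scaleR lie_bilinear lie_self step_pos)

lemma abs_inner_diff_le: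
  assumes "v \<in> hor"
  shows "\<bar>y \<bullet> v - x \<bullet> v\<bar> \<le> d x y * norm v"
  using abs_inner_le[OF assms, of "- x \<odot> y"] by (simp add: hom_dist_def inner_mult[OF assms])

section \<open>Continuity and measurability of the distance\<close>

lemma continuous_on_mult: "continuous_on UNIV ((\<odot>) x)"
  using continuous_on_bch[OF lie_bilinear] by (simp add: gop_bch[abs_def])

lemma continuous_on_component:
  assumes "i \<in> {1..step G}"
  shows "continuous_on UNIV (comp i)"
  using component_linear[OF assms] by (simp add: linear_continuous_on linear_conv_bounded_linear)

lemma continuous_on_hnorm: "continuous_on UNIV hnorm"
proof -
  have "continuous_on UNIV (\<lambda>x. eps G i * root i (norm (comp i x)))" if "i \<in> {1..step G}" for i
    using continuous_on_component[OF that] by (intro continuous_intros)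
  then show ?thesis
    unfolding hom_norm_def[abs_def] using one_in by (intro continuous_on_Max_image) auto
qed

lemma continuous_on_d: "continuous_on UNIV (d x)"
  unfolding hom_dist_def[abs_def]
  using continuous_on_compose2[OF continuous_on_hnorm continuous_on_mult] by simp

lemma borel_measurable_d [measurable]: "d x \<in> borel_measurable borel"
  using continuous_on_d borel_measurable_continuous_onI by blast

lemma borel_hball [measurable]: "hball G x r \<in> sets borel"
proof -
  have "hball G x r = d x -` {..<r} \<inter> space borel" by auto
  then show ?thesis using measurable_sets[OF borel_measurable_d, of "{..<r}"] by simp
qed

lemma borel_hcball [measurable]: "hcball G x r \<in> sets borel"
proof -
  have "hcball G x r = d x -` {..r} \<inter> space borel" by auto
  then show ?thesis using measurable_sets[OF borel_measurable_d, of "{..r}"] by simp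
qed

section \<open>Vertical hyperplanes\<close>

text \<open>A hyperplane of \<open>hor\<close> has an orthogonal direction in \<open>hor\<close>,
  and the higher layers are orthogonal to \<open>hor\<close> anyway, so a normal exists. The plane
  is then the kernel of the homomorphism given by its normal.\<close>

lemma plane_normal_works:
  assumes "V \<in> Gr G"
  shows plane_normal_hor: "plane_normal G V \<in> hor"
    and norm_plane_normal: "norm (plane_normal G V) = 1"
    and plane_iff: "g \<in> V \<longleftrightarrow> g \<bullet> plane_normal G V = 0"
proof -
  obtain W where W: "subspace W" "W \<subseteq> hor" "dim W + 1 = dim hor"
    and V: "V = span (W \<union> (\<Union>i\<in>{2..step G}. layer G i))"
    using assms unfolding Gr_def by blast
  let ?n = "plane_normal G V"
  have "W \<noteq> hor" using W by auto
  with W have "span W \<subset> span hor"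
    using hor_subspace by (metis psubsetI span_eq_iff)
  then obtain u where u: "u \<noteq> 0" "u \<in> span hor" "\<And>y. y \<in> span W \<Longrightarrow> orthogonal u y"
    using orthogonal_to_subspace_exists_gen by blast
  have uh: "u \<in> hor" using u hor_subspace span_eq_iff by blast
  define n where "n = u /\<^sub>R norm u"
  have n: "n \<in> hor" "norm n = 1"
    using u uh hor_subspace by (auto simp: n_def subspace_scale)
  have "n \<bullet> y = 0" if y: "y \<in> W \<union> (\<Union>i\<in>{2..step G}. layer G i)" for y
  proof -
    have "u \<bullet> y = 0"
    proof (cases "y \<in> W")
      case True
      then show ?thesis
        using u(3)[of y] by (simp add: orthogonal_def span_base)
    next
      case False
      then obtain i where "i \<in> {2..step G}" "y \<in> layer G i"
        using y by blast
      then show ?thesis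
        using layer_orth[of 1 i u y] uh by auto
    qed
    then show ?thesis by (simp add: n_def)
  qed
  then have "orthogonal n v" if "v \<in> V" for v
    using that unfolding V by (metis orthogonal_def orthogonal_to_span)
  with n have "n \<in> hor \<and> norm n = 1 \<and> (\<forall>v\<in>V. orthogonal n v)"
    by blast
  then have *: "?n \<in> hor \<and> norm ?n = 1 \<and> (\<forall>v\<in>V. orthogonal ?n v)"
    unfolding plane_normal_def by (rule someI)
  then show "?n \<in> hor" "norm ?n = 1" by auto
  show "g \<in> V \<longleftrightarrow> g \<bullet> ?n = 0"
  proof -
    \<comment> \<open>The horizontal part of the kernel. It contains \<open>W\<close> and is proper
      in \<open>hor\<close> because it misses the normal; as \<open>W\<close> has codimension one,
      the two agree.\<close>
    define H where "H = {v\<in>hor. v \<bullet> ?n = 0}"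
    have subH: "subspace H"
      using hor_subspace unfolding H_def subspace_def by (auto simp: inner_simps)
    have "W \<subseteq> H"
    proof
      fix w assume "w \<in> W"
      then have "w \<in> V" unfolding V by (intro span_base) auto
      with * have "orthogonal ?n w" by blast
      then show "w \<in> H"
        using \<open>w \<in> W\<close> W by (auto simp: H_def orthogonal_def inner_commute)
    qed
    have "?n \<notin> H" using * by (auto simp: H_def dot_square_norm)
    moreover have "H \<subseteq> hor" by (auto simp: H_def)
    ultimately have "H \<subset> hor" using * by blast
    moreover have "span H = H" "span hor = hor"
      using subH hor_subspace by (auto simp: span_eq_iff)
    ultimately have "dim H < dim hor"
      by (intro dim_psubset) (simp only:)
    then have "W = H"
      using W subH \<open>W \<subseteq> H\<close> by (intro subspace_dim_equal) auto
    show "g \<in> V \<longleftrightarrow> g \<bullet> ?n = 0"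
    proof
      assume "g \<in> V"
      with * have "orthogonal ?n g" by blast
      then show "g \<bullet> ?n = 0" by (simp add: orthogonal_def inner_commute)
    next
      assume g: "g \<bullet> ?n = 0"
      then have "comp 1 g \<in> H"
        using * component_in[OF one_in] inner_hor[of ?n g] by (simp add: H_def)
      then have "comp i g \<in> V" if i: "i \<in> {1..step G}" for i
      proof (cases "i = 1")
        case True
        with \<open>comp 1 g \<in> H\<close> show ?thesis
          unfolding V \<open>W = H\<close> by (auto intro: span_base)
      next
        case False
        with i component_in[OF i, of g] show ?thesis
          unfolding V by (intro span_base) auto
      qed
      then have "(\<Sum>i = 1..step G. comp i g) \<in> V"
        unfolding V by (intro span_sum)
      then show "g \<in> V" by (simp add: sum_component)
    qed
  qed
qed

lemma Gr_zero: "V \<in> Gr G \<Longrightarrow> 0 \<in> V"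
  by (simp add: plane_iff)

lemma hom_dim_pos:
  assumes "V \<in> Gr G"
  shows "1 \<le> hom_dim G"
proof -
  have "dim (layer G 1) \<ge> 1"
    using assms unfolding Gr_def by auto
  also have "dim (layer G 1) \<le> (\<Sum>i = 1..step G. i * dim (layer G i))"
    using one_in member_le_sum[of 1 "{1..step G}" "\<lambda>i. i * dim (layer G i)"] by auto
  finally show ?thesis by (simp add: hom_dim_def)
qed

text \<open>The normal coordinate of \<open>g\<close> is additive, so it determines the factor in
  the normal line; multiplying by the inverse of that factor leaves the factor in
  \<open>V\<close>.\<close>

lemma splitting_projection_eq:
  assumes "V \<in> Gr G"
  shows "splitting_projection G V g = g \<odot> ((- (g \<bullet> plane_normal G V)) *\<^sub>R plane_normal G V)"
proof -
  let ?n = "plane_normal G V" and ?a = "g \<bullet> plane_normal G V"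
  note n = plane_normal_hor[OF assms] norm_plane_normal[OF assms]
  have nn: "?n \<bullet> ?n = 1" using n(2) by (simp add: dot_square_norm)
  show ?thesis
    unfolding splitting_projection_def
  proof (rule the_equality)
    have "g = g \<odot> ((- ?a) *\<^sub>R ?n) \<odot> (?a *\<^sub>R ?n)"
      unfolding assoc mult_scaleR by simp
    moreover have "g \<odot> ((- ?a) *\<^sub>R ?n) \<in> V"
      using nn by (simp add: plane_iff[OF assms] inner_mult[OF n(1)])
    ultimately show "g \<odot> ((- ?a) *\<^sub>R ?n) \<in> V \<and>
        (\<exists>q\<in>normal_line G V. g = g \<odot> ((- ?a) *\<^sub>R ?n) \<odot> q)"
      by (auto simp: normal_line_def span_singleton)
    fix p assume "p \<in> V \<and> (\<exists>q\<in>normal_line G V. g = p \<odot> q)"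
    then obtain t where p: "p \<in> V" and g: "g = p \<odot> (t *\<^sub>R ?n)"
      by (auto simp: normal_line_def span_singleton)
    then have "t = ?a"
      using nn by (simp add: plane_iff[OF assms] inner_mult[OF n(1)])
    then show "p = g \<odot> ((- ?a) *\<^sub>R ?n)"
      using g unfolding \<open>t = ?a\<close>[symmetric] g assoc mult_scaleR by simp
  qed
qed

end


section \<open>Hausdorff measures of vertical hyperplanes\<close>

lemma ennreal_tendsto_multc:
  "(c::ennreal) < top \<Longrightarrow> (f \<longlongrightarrow> x) F \<Longrightarrow> ((\<lambda>x. f x * c) \<longlongrightarrow> x * c) F"
  using ennreal_tendsto_cmult[of c f x F] by (simp only: mult.commute)

lemma ennreal_le_mult_INF:
  fixes f :: "'b \<Rightarrow> ennreal"
  assumes "0 < c" "\<And>i. i \<in> A \<Longrightarrow> x \<le> ennreal c * f i"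
  shows "x \<le> ennreal c * (INF i\<in>A. f i)"
proof -
  have inv: "ennreal c * (ennreal (1 / c) * y) = y" "ennreal (1 / c) * (ennreal c * y) = y" for y
    using assms(1) by (simp_all add: mult.assoc[symmetric] ennreal_mult'[symmetric])
  have "ennreal (1 / c) * x \<le> (INF i\<in>A. f i)"
    using mult_left_mono[OF assms(2), of _ "ennreal (1 / c)"] by (intro INF_greatest) (simp add: inv)
  then have "ennreal c * (ennreal (1 / c) * x) \<le> ennreal c * (INF i\<in>A. f i)"
    by (intro mult_left_mono) auto
  then show ?thesis by (simp add: inv)
qed

context carnot_grp
begin

section \<open>Outer measures under translations and dilations\<close>

abbreviation sph where "sph \<equiv> spherical_outer G"
abbreviation haus where "haus \<equiv> hausdorff_outer G"

text \<open>A similarity maps a closed ball into the ball of scaled radius around the image of its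
  centre, so a covering at scale \<open>\<delta> / l\<close> becomes one at scale
  \<open>\<delta>\<close>.\<close>

lemma spherical_similarity_le:
  assumes "0 < l" and f: "\<And>x y. d (f x) (f y) = l * d x y"
  shows "sph m (f ` A) \<le> ennreal (l ^ m) * sph m A"
  unfolding spherical_outer_def[of G m "f ` A"]
proof (rule SUP_least)
  fix \<delta> :: real assume "\<delta> \<in> {0<..}"
  then have \<delta>: "0 < \<delta> / l" using assms by simp
  let ?cov = "\<lambda>\<delta> A. {(I :: nat set, c, \<rho>). (\<forall>i\<in>I. 0 < \<rho> i \<and> \<rho> i \<le> \<delta>) \<and> A \<subseteq> (\<Union>i\<in>I. hcball G (c i) (\<rho> i))}"
  let ?cost = "\<lambda>(I, c :: nat \<Rightarrow> 'a, \<rho>). \<Sum>i. if i \<in> I then ennreal (\<rho> i ^ m) else 0"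
  have "(INF C\<in>?cov \<delta> (f ` A). ?cost C) \<le> ennreal (l ^ m) * (INF C\<in>?cov (\<delta> / l) A. ?cost C)"
  proof (rule ennreal_le_mult_INF)
    show "0 < l ^ m" using assms(1) by simp
    fix C assume "C \<in> ?cov (\<delta> / l) A"
    then obtain I c \<rho> where C: "C = (I, c, \<rho>)" "\<forall>i\<in>I. 0 < \<rho> i \<and> \<rho> i \<le> \<delta> / l"
        "A \<subseteq> (\<Union>i\<in>I. hcball G (c i) (\<rho> i))"
      by auto
    have "f ` A \<subseteq> (\<Union>i\<in>I. hcball G (f (c i)) (l * \<rho> i))"
    proof
      fix y assume "y \<in> f ` A"
      then obtain x i where "y = f x" "i \<in> I" "d (c i) x \<le> \<rho> i"
        using C(3) by fastforce
      then show "y \<in> (\<Union>i\<in>I. hcball G (f (c i)) (l * \<rho> i))"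
        using assms by (auto intro!: bexI[of _ i])
    qed
    then have "(I, f \<circ> c, \<lambda>i. l * \<rho> i) \<in> ?cov \<delta> (f ` A)"
      using C(2) assms(1) by (auto simp: field_simps)
    then have "(INF C\<in>?cov \<delta> (f ` A). ?cost C) \<le> ?cost (I, f \<circ> c, \<lambda>i. l * \<rho> i)"
      by (rule INF_lower)
    also have "\<dots> = (\<Sum>i. ennreal (l ^ m) * (if i \<in> I then ennreal (\<rho> i ^ m) else 0))"
      unfolding prod.case
    proof (rule suminf_cong)
      fix i
      show "(if i \<in> I then ennreal ((l * \<rho> i) ^ m) else 0) =
          ennreal (l ^ m) * (if i \<in> I then ennreal (\<rho> i ^ m) else 0)"
        using C(2) assms(1) by (simp add: power_mult_distrib ennreal_mult less_imp_le)
    qed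
    also have "\<dots> = ennreal (l ^ m) * ?cost C"
      unfolding C(1) prod.case by (rule ennreal_suminf_cmult)
    finally show "(INF C\<in>?cov \<delta> (f ` A). ?cost C) \<le> ennreal (l ^ m) * ?cost C" .
  qed
  also have "\<dots> \<le> ennreal (l ^ m) * sph m A"
    unfolding spherical_outer_def using \<delta> by (intro mult_left_mono SUP_upper) auto
  finally show "(INF C\<in>?cov \<delta> (f ` A). ?cost C) \<le> ennreal (l ^ m) * sph m A" .
qed

lemma spherical_left: "sph m ((\<odot>) g ` A) = sph m A"
proof (rule antisym)
  show le: "sph m ((\<odot>) g ` A) \<le> sph m A" for g A
    using spherical_similarity_le[of 1 "(\<odot>) g"] by (simp add: d_left)
  have "(\<odot>) (- g) ` (\<odot>) g ` A = A"
    by (force simp: assoc[symmetric])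
  then show "sph m A \<le> sph m ((\<odot>) g ` A)"
    using le[of "- g" "(\<odot>) g ` A"] by simp
qed

lemma spherical_dil:
  assumes "0 < l"
  shows "sph m (dil l ` A) = ennreal (l ^ m) * sph m A"
proof (rule antisym)
  show le: "sph m (dil l ` A) \<le> ennreal (l ^ m) * sph m A"
    using spherical_similarity_le[OF assms d_dil[OF assms]] .
  have "ennreal (l ^ m) * sph m A = ennreal (l ^ m) * sph m (dil (1 / l) ` dil l ` A)"
    using assms by (simp add: image_image dil_dil dil_1)
  also have "\<dots> \<le> ennreal (l ^ m) * (ennreal ((1 / l) ^ m) * sph m (dil l ` A))"
    using assms by (intro mult_left_mono spherical_similarity_le d_dil) auto
  also have "\<dots> = sph m (dil l ` A)"
    using assms by (simp add: mult.assoc[symmetric] ennreal_mult'[symmetric] power_mult_distrib[symmetric])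
  finally show "ennreal (l ^ m) * sph m A \<le> sph m (dil l ` A)" .
qed

lemma hdiam_left: "hdiam G ((\<odot>) g ` C) = hdiam G C"
  by (simp add: hdiam_def d_left image_image)

lemma hausdorff_left_le: "haus m ((\<odot>) g ` A) \<le> haus m A"
  unfolding hausdorff_outer_def
proof (rule SUP_mono, rule bexI, rule INF_greatest)
  fix \<delta> :: real and C
  let ?cov = "\<lambda>A. {(I :: nat set, C). (\<forall>i\<in>I. hdiam G (C i) \<le> ennreal \<delta>) \<and> A \<subseteq> (\<Union>i\<in>I. C i)}"
  let ?cost = "\<lambda>(I, C). \<Sum>i. if i \<in> I then (hdiam G (C i) / 2) ^ m else 0"
  assume "C \<in> ?cov A"
  then obtain I D where C: "C = (I, D)" "\<forall>i\<in>I. hdiam G (D i) \<le> ennreal \<delta>" "A \<subseteq> (\<Union>i\<in>I. D i)"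
    by auto
  then have "(\<odot>) g ` A \<subseteq> (\<Union>i\<in>I. (\<odot>) g ` D i)"
    by blast
  with C have "(I, \<lambda>i. (\<odot>) g ` D i) \<in> ?cov ((\<odot>) g ` A)"
    by (simp add: hdiam_left)
  then have "(INF C\<in>?cov ((\<odot>) g ` A). ?cost C) \<le> ?cost (I, \<lambda>i. (\<odot>) g ` D i)"
    by (rule INF_lower)
  then show "(INF C\<in>?cov ((\<odot>) g ` A). ?cost C) \<le> ?cost C"
    unfolding C(1) prod.case hdiam_left .
qed

lemma hausdorff_left: "haus m ((\<odot>) g ` A) = haus m A"
proof (rule antisym[OF hausdorff_left_le])
  have "(\<odot>) (- g) ` (\<odot>) g ` A = A"
    by (force simp: assoc[symmetric])
  then show "haus m A \<le> haus m ((\<odot>) g ` A)"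
    using hausdorff_left_le[of m "- g" "(\<odot>) g ` A"] by simp
qed

lemma hausdorff_mono: "A \<subseteq> B \<Longrightarrow> haus m A \<le> haus m B"
  unfolding hausdorff_outer_def
  by (intro SUP_mono bexI INF_superset_mono) auto

text \<open>\<open>V\<close> is invariant under its own translations and under dilations, so the
  piece of the coset is a translated dilate of the unit ball of \<open>V\<close>.\<close>

lemma spherical_plane_ball:
  assumes "V \<in> Gr G" "v \<in> V" "0 < \<rho>"
  shows "sph m ((\<odot>) x ` V \<inter> hcball G (x \<odot> v) \<rho>) = ennreal (\<rho> ^ m) * sph m (V \<inter> hcball G 0 1)"
proof -
  note n = plane_normal_hor[OF assms(1)] and V = plane_iff[OF assms(1)]
  have "(\<odot>) x ` V \<inter> hcball G (x \<odot> v) \<rho> = (\<odot>) (x \<odot> v) ` dil \<rho> ` (V \<inter> hcball G 0 1)"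
  proof (intro equalityI subsetI)
    fix y assume "y \<in> (\<odot>) x ` V \<inter> hcball G (x \<odot> v) \<rho>"
    then obtain w where w: "y = x \<odot> w" "w \<in> V" "d v w \<le> \<rho>"
      by (auto simp: d_left)
    let ?u = "dil (1 / \<rho>) (- v \<odot> w)"
    have "?u \<in> V"
      using w(2) assms(2) by (simp add: V inner_dil[OF n] inner_mult[OF n])
    moreover have "hnorm ?u \<le> 1"
      using w(3) assms(3) by (simp add: hnorm_dil hom_dist_def)
    moreover have "y = (x \<odot> v) \<odot> dil \<rho> ?u"
      using assms(3) by (simp add: dil_dil dil_1 w assoc) (simp add: assoc[symmetric])
    ultimately show "y \<in> (\<odot>) (x \<odot> v) ` dil \<rho> ` (V \<inter> hcball G 0 1)"
      by (auto simp: d_0)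
  next
    fix y assume "y \<in> (\<odot>) (x \<odot> v) ` dil \<rho> ` (V \<inter> hcball G 0 1)"
    then obtain u where u: "y = x \<odot> (v \<odot> dil \<rho> u)" "u \<in> V" "hnorm u \<le> 1"
      by (auto simp: d_0 assoc)
    then have "v \<odot> dil \<rho> u \<in> V"
      using assms(2) by (simp add: V inner_dil[OF n] inner_mult[OF n])
    moreover have "d (x \<odot> v) y \<le> \<rho>"
      using u assms(3) by (simp add: d_left d_mult hnorm_dil)
    ultimately show "y \<in> (\<odot>) x ` V \<inter> hcball G (x \<odot> v) \<rho>"
      using u(1) by auto
  qed
  then show ?thesis
    by (simp add: spherical_left spherical_dil assms(3))
qed

lemma borel_coset:
  assumes "V \<in> Gr G"
  shows "(\<odot>) x ` V \<in> sets borel"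
proof -
  let ?n = "plane_normal G V"
  note n = plane_normal_hor[OF assms] and V = plane_iff[OF assms]
  have "(\<odot>) x ` V = {y. y \<bullet> ?n = x \<bullet> ?n}"
  proof (intro equalityI subsetI)
    fix y assume "y \<in> {y. y \<bullet> ?n = x \<bullet> ?n}"
    then have "- x \<odot> y \<in> V"
      by (simp add: V inner_mult[OF n])
    moreover have "y = x \<odot> (- x \<odot> y)"
      by (simp add: assoc[symmetric])
    ultimately show "y \<in> (\<odot>) x ` V" by blast
  qed (auto simp: V inner_mult[OF n])
  moreover have "closed {y. y \<bullet> ?n = x \<bullet> ?n}"
    by (intro closed_Collect_eq continuous_intros)
  ultimately show ?thesis by simp
qed

lemma borel_plane:
  assumes "V \<in> Gr G"
  shows "V \<in> sets borel"
  using borel_coset[OF assms, of 0] by simp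

section \<open>Measure of balls, packings and coverings in a plane\<close>

lemma sets_spherical [simp]: "sets (spherical_measure G m) = sets borel"
  and sets_hausdorff [simp]: "sets (hausdorff_measure G m) = sets borel"
  and space_spherical [simp]: "space (spherical_measure G m) = UNIV"
  and space_hausdorff [simp]: "space (hausdorff_measure G m) = UNIV"
  by (simp_all add: spherical_measure_def hausdorff_measure_def sets_measure_of_conv
      space_measure_of_conv sets.sigma_sets_eq[of borel, simplified])

text \<open>\<open>measure_of\<close> returns the null measure unless the given function is a measure, which is
  why a positive value suffices here.\<close>

lemma emeasure_spherical:
  assumes "emeasure (spherical_measure G m) A \<noteq> 0" "B \<in> sets borel"
  shows "emeasure (spherical_measure G m) B = sph m B"
  using assms unfolding spherical_measure_def emeasure_measure_of_conv
  by (auto simp: sets.sigma_sets_eq[of borel, simplified] split: if_splits)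

lemma emeasure_hausdorff:
  assumes "emeasure (hausdorff_measure G m) A \<noteq> 0" "B \<in> sets borel"
  shows "emeasure (hausdorff_measure G m) B = haus m B"
  using assms unfolding hausdorff_measure_def emeasure_measure_of_conv
  by (auto simp: sets.sigma_sets_eq[of borel, simplified] split: if_splits)

text \<open>Formulated with \<open>emeasure\<close> instead of \<open>sph\<close>: a nonzero value
  excludes the null default of \<open>measure_of\<close>, so that the two agree on Borel
  sets.\<close>

definition regular_plane :: "nat \<Rightarrow> 'a set \<Rightarrow> bool" where
  "regular_plane m V \<longleftrightarrow> V \<in> Gr G \<and>
     emeasure (spherical_measure G m) (V \<inter> hcball G 0 1) \<noteq> 0 \<and>
     emeasure (spherical_measure G m) (V \<inter> hcball G 0 1) < \<infinity>"

lemma emeasure_regular_ball: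
  assumes "regular_plane m V" "v \<in> V" "0 < \<rho>"
  shows "emeasure (spherical_measure G m) (V \<inter> hcball G v \<rho>) =
         ennreal (\<rho> ^ m) * emeasure (spherical_measure G m) (V \<inter> hcball G 0 1)"
proof -
  have V: "V \<in> Gr G" using assms by (simp add: regular_plane_def)
  have "emeasure (spherical_measure G m) (V \<inter> hcball G v \<rho>) = sph m (V \<inter> hcball G v \<rho>)" for v \<rho>
    using assms(1) borel_plane[OF V] emeasure_spherical[of m "V \<inter> hcball G 0 1"]
    by (simp add: regular_plane_def)
  then show ?thesis
    using spherical_plane_ball[OF V assms(2,3), of m 0] by simp
qed

lemma emeasure_regular_ball_le:
  assumes "regular_plane m V" "v \<in> V" "0 \<le> \<rho>"
  shows "emeasure (spherical_measure G m) (V \<inter> hcball G v \<rho>) \<le>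
         ennreal (\<rho> ^ m) * emeasure (spherical_measure G m) (V \<inter> hcball G 0 1)"
proof (cases "0 < \<rho>")
  case True
  then show ?thesis using emeasure_regular_ball[OF assms(1,2)] by simp
next
  case False
  let ?M = "spherical_measure G m" and ?k = "emeasure (spherical_measure G m) (V \<inter> hcball G 0 1)"
  have V: "V \<in> sets borel" using assms by (simp add: regular_plane_def borel_plane)
  have \<rho>: "\<rho> = 0" using False assms by simp
  have le: "emeasure ?M (V \<inter> hcball G v 0) \<le> ennreal (t ^ m) * ?k" if "0 < t" for t
  proof -
    have "emeasure ?M (V \<inter> hcball G v 0) \<le> emeasure ?M (V \<inter> hcball G v t)"
      using that V by (intro emeasure_mono) auto
    then show ?thesis using emeasure_regular_ball[OF assms(1,2) that] by simp
  qed
  have "((\<lambda>t. ennreal (t ^ m) * ?k) \<longlongrightarrow> ennreal (0 ^ m) * ?k) (at_right 0)"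
    using assms(1) unfolding regular_plane_def
    by (intro ennreal_tendsto_multc tendsto_ennrealI tendsto_intros) auto
  then show ?thesis
    unfolding \<rho>
    by (rule tendsto_lowerbound) (use le in \<open>auto intro: eventually_mono[OF eventually_at_right_less]\<close>)
qed

text \<open>Volume packing: the pieces of radius \<open>b / 3\<close> around the points of
  \<open>F\<close> are disjoint and lie in the ball of radius \<open>2 * R\<close>.\<close>

lemma separated_card_le:
  assumes V: "regular_plane m V" and "0 < b" "b \<le> R"
    and F: "finite F" "F \<subseteq> V \<inter> hcball G 0 R" "\<And>x y. \<lbrakk>x \<in> F; y \<in> F; x \<noteq> y\<rbrakk> \<Longrightarrow> b < d x y"
  shows "real (card F) \<le> (6 * R / b) ^ m"
proof -
  let ?M = "spherical_measure G m" and ?k = "emeasure (spherical_measure G m) (V \<inter> hcball G 0 1)"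
  have Vb: "V \<in> sets borel" and V0: "0 \<in> V" using V by (simp_all add: regular_plane_def borel_plane Gr_zero)
  have disj: "disjoint_family_on (\<lambda>f. V \<inter> hcball G f (b / 3)) F"
    unfolding disjoint_family_on_def
  proof (intro ballI impI, rule ccontr)
    fix x y assume xy: "x \<in> F" "y \<in> F" "x \<noteq> y" "V \<inter> hcball G x (b / 3) \<inter> (V \<inter> hcball G y (b / 3)) \<noteq> {}"
    then obtain z where "d x z \<le> b / 3" "d y z \<le> b / 3" by auto
    then show False
      using F(3)[OF xy(1-3)] d_tri[of x y z] d_comm[of y z] assms(2) by simp
  qed
  have "ennreal (real (card F) * (b / 3) ^ m) * ?k = (\<Sum>f\<in>F. ennreal ((b / 3) ^ m) * ?k)"
    using assms(2) by (simp add: ennreal_mult ennreal_of_nat_eq_real_of_nat mult.assoc)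
  also have "\<dots> = (\<Sum>f\<in>F. emeasure ?M (V \<inter> hcball G f (b / 3)))"
    using F assms(2) emeasure_regular_ball[OF V] by (intro sum.cong) auto
  also have "\<dots> = emeasure ?M (\<Union>f\<in>F. V \<inter> hcball G f (b / 3))"
    using F disj Vb by (intro sum_emeasure) auto
  also have "\<dots> \<le> emeasure ?M (V \<inter> hcball G 0 (2 * R))"
  proof (rule emeasure_mono)
    show "(\<Union>f\<in>F. V \<inter> hcball G f (b / 3)) \<subseteq> V \<inter> hcball G 0 (2 * R)"
    proof
      fix y assume "y \<in> (\<Union>f\<in>F. V \<inter> hcball G f (b / 3))"
      then obtain f where f: "f \<in> F" "y \<in> V" "d f y \<le> b / 3" by auto
      then have "d 0 f \<le> R" using F(2) by auto
      then show "y \<in> V \<inter> hcball G 0 (2 * R)"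
        using f d_tri[of 0 y f] assms(2,3) by auto
    qed
  qed (use Vb in simp)
  also have "\<dots> = ennreal ((2 * R) ^ m) * ?k"
    using V V0 assms by (intro emeasure_regular_ball) auto
  finally have "ennreal (real (card F) * (b / 3) ^ m) \<le> ennreal ((2 * R) ^ m)"
    using V unfolding regular_plane_def
    by (metis ennreal_mult_le_mult_iff infinity_ennreal_def mult.commute order_less_irrefl)
  then have "real (card F) * (b / 3) ^ m \<le> (2 * R) ^ m"
    using assms by (simp add: ennreal_le_iff)
  then have "real (card F) \<le> (2 * R) ^ m / (b / 3) ^ m"
    using assms by (simp add: pos_le_divide_eq)
  also have "\<dots> = (6 * R / b) ^ m"
    unfolding power_divide[symmetric] by simp
  finally show ?thesis .
qed

text \<open>A largest separated set exists by the packing bound; it covers, since an uncovered point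
  could be added.\<close>

lemma covering_card_le:
  assumes V: "regular_plane m V" and "0 < b" "b \<le> R"
  obtains F where "finite F" "F \<subseteq> V \<inter> hcball G 0 R" "real (card F) \<le> (6 * R / b) ^ m"
    "V \<inter> hcball G 0 R \<subseteq> (\<Union>f\<in>F. hcball G f b)"
proof -
  define sep where "sep F \<longleftrightarrow> finite F \<and> F \<subseteq> V \<inter> hcball G 0 R \<and>
      (\<forall>x\<in>F. \<forall>y\<in>F. x \<noteq> y \<longrightarrow> b < d x y)" for F
  have bound: "real (card F) \<le> (6 * R / b) ^ m" if "sep F" for F
    using that separated_card_le[OF assms, of F] unfolding sep_def by blast
  have "sep {}" by (simp add: sep_def)
  moreover have "\<forall>F. sep F \<longrightarrow> card F < Suc (nat \<lceil>(6 * R / b) ^ m\<rceil>)"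
    using bound by (smt (verit) le_imp_less_Suc of_nat_ceiling of_nat_le_iff)
  ultimately obtain F where F: "sep F" "\<And>F'. sep F' \<Longrightarrow> card F' \<le> card F"
    using ex_has_greatest_nat[of sep "{}" card] by blast
  have "V \<inter> hcball G 0 R \<subseteq> (\<Union>f\<in>F. hcball G f b)"
  proof (rule ccontr)
    assume "\<not> ?thesis"
    then obtain w where w: "w \<in> V \<inter> hcball G 0 R" "w \<notin> (\<Union>f\<in>F. hcball G f b)"
      by blast
    then have far: "b < d f w" if "f \<in> F" for f
      using that by (auto simp: not_le)
    then have "w \<notin> F"
      using assms(2) far[of w] by auto
    have "b < d w f" if "f \<in> F" for f
      using far[OF that] d_comm[of w f] by simp
    then have "sep (insert w F)"
      using F(1) w far unfolding sep_def by auto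
    then show False
      using F(2)[of "insert w F"] F(1) \<open>w \<notin> F\<close> by (simp add: sep_def)
  qed
  then show thesis
    using that F(1) bound by (auto simp: sep_def)
qed

section \<open>Size of conjugated balls\<close>

lemma hdiam_ge:
  assumes "x \<in> C" "y \<in> C"
  shows "ennreal (d x y) \<le> hdiam G C"
  unfolding hdiam_def using assms by (intro SUP_upper2[of x] SUP_upper2[of y]) auto

text \<open>Conjugation by \<open>h\<close> distorts small balls of \<open>V\<close> by an amount that depends on \<open>h\<close>, but it changes norms by at
  most \<open>2\<parallel>h\<parallel>\<close>, so it is harmless on balls of radius \<open>R \<ge> 4\<parallel>h\<parallel>\<close>.  Covering such a big ball by balls of radius
  \<open>b\<close> transfers the estimate to the small scale: translates of a covering of the conjugated small ball
  cover a ball of radius \<open>R/2\<close>.\<close>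

lemma hausdorff_conjugated_ball_ge:
  assumes V: "regular_plane m V" and b: "0 < b"
  shows "ennreal ((b / 24) ^ m) \<le> haus m ((\<lambda>w. h \<odot> w \<odot> - h) ` (V \<inter> hcball G 0 b))"
    (is "_ \<le> haus m ?D")
proof -
  let ?M = "spherical_measure G m" and ?k = "emeasure (spherical_measure G m) (V \<inter> hcball G 0 1)"
  have VG: "V \<in> Gr G" using V by (simp add: regular_plane_def)
  have Vb: "V \<in> sets borel" and V0: "0 \<in> V" using VG by (simp_all add: borel_plane Gr_zero)
  note Viff = plane_iff[OF VG] and n = plane_normal_hor[OF VG]
  have k: "?k \<noteq> 0" "?k \<noteq> top" using V by (auto simp: regular_plane_def)
  \<comment> \<open>With \<open>4 * hnorm h \<le> R\<close>, the inverse conjugation maps the ball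
    of radius \<open>R / 2\<close> into the ball of radius \<open>R\<close>.\<close>
  define R where "R = max b (4 * hnorm h)"
  have R: "b \<le> R" "4 * hnorm h \<le> R" "0 < R" using b by (auto simp: R_def)
  obtain F where F: "finite F" "F \<subseteq> V \<inter> hcball G 0 R" "real (card F) \<le> (6 * R / b) ^ m"
    "V \<inter> hcball G 0 R \<subseteq> (\<Union>f\<in>F. hcball G f b)"
    using covering_card_le[OF V b R(1)] .
  \<comment> \<open>The single scale \<open>\<delta> = 1\<close> suffices, as \<open>haus\<close> is
    a supremum over scales; it makes the diameters finite.\<close>
  have cost: "ennreal ((b / 24) ^ m) \<le> (\<Sum>i. if i \<in> I then (hdiam G (C i) / 2) ^ m else 0)"
    if C: "\<forall>i\<in>I. hdiam G (C i) \<le> ennreal 1" "?D \<subseteq> (\<Union>i\<in>I. C i)" for I :: "nat set" and C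
  proof -
    define J where "J = {i\<in>I. C i \<inter> ?D \<noteq> {}}"
    define c where "c i = (SOME x. x \<in> C i \<inter> ?D)" for i
    have c: "c i \<in> C i" "c i \<in> ?D" if "i \<in> J" for i
    proof -
      have "\<exists>x. x \<in> C i \<inter> ?D" using that unfolding J_def by blast
      then have "c i \<in> C i \<inter> ?D" unfolding c_def by (rule someI_ex)
      then show "c i \<in> C i" "c i \<in> ?D" by auto
    qed
    define e where "e i = enn2real (hdiam G (C i))" for i
    have e: "hdiam G (C i) = ennreal (e i)" if "i \<in> J" for i
      using that C(1) unfolding e_def J_def
      by (metis (mono_tags, lifting) ennreal_enn2real ennreal_one_less_top le_less_trans ennreal_1 mem_Collect_eq)
    have e0: "0 \<le> e i" for i by (simp add: e_def)
    \<comment> \<open>The ball around \<open>c i\<close> with radius the diameter contains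
      \<open>C i\<close>. \<open>B f i\<close> is the trace on \<open>V\<close> of this ball
      translated by \<open>h \<odot> f \<odot> - h\<close>; the new centre lies in \<open>V\<close>
      by additivity of the normal coordinate.\<close>
    define B where "B f i = (if i \<in> J then V \<inter> hcball G (h \<odot> f \<odot> - h \<odot> c i) (e i) else {})" for f i
    have B_meas: "B f i \<in> sets ?M" for f i using Vb by (simp add: B_def)
    have B_le: "emeasure ?M (B f i) \<le> (if i \<in> I then (hdiam G (C i) / 2) ^ m else 0) * (ennreal (2 ^ m) * ?k)"
      if f: "f \<in> F" for f i
    proof (cases "i \<in> J")
      case True
      have "h \<odot> f \<odot> - h \<odot> c i \<in> V"
        using c(2)[OF True] F(2) f by (auto simp: Viff inner_mult[OF n])
      then have "emeasure ?M (B f i) \<le> ennreal (e i ^ m) * ?k"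
        using emeasure_regular_ball_le[OF V _ e0, of "h \<odot> f \<odot> - h \<odot> c i" i] True by (simp add: B_def)
      also have "ennreal (e i ^ m) = ennreal ((e i / 2) ^ m) * ennreal (2 ^ m)"
        using e0 by (simp add: ennreal_mult[symmetric] power_mult_distrib[symmetric])
      also have "ennreal ((e i / 2) ^ m) = (hdiam G (C i) / 2) ^ m"
        using e0[of i] by (simp add: e[OF True] ennreal_power[symmetric] divide_ennreal[symmetric])
      finally show ?thesis
        using True by (simp add: J_def mult.assoc)
    qed (simp add: B_def)
    have "V \<inter> hcball G 0 (R / 2) \<subseteq> (\<Union>f\<in>F. \<Union>i. B f i)"
    proof
      fix w assume w: "w \<in> V \<inter> hcball G 0 (R / 2)"
      \<comment> \<open>Conjugate \<open>w\<close> back, split off a nearby \<open>f\<close>, and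
        conjugate the remainder \<open>?u\<close> forward into \<open>?D\<close>.\<close>
      let ?w = "- h \<odot> w \<odot> h"
      have "hnorm ?w \<le> hnorm h + hnorm w + hnorm h"
        using hnorm_mult[of "- h \<odot> w" h] hnorm_mult[of "- h" w] by (simp add: hnorm_minus)
      then have "?w \<in> V \<inter> hcball G 0 R"
        using w R by (auto simp: Viff inner_mult[OF n] d_0)
      then obtain f where f: "f \<in> F" "d f ?w \<le> b" using F(4) by auto
      let ?u = "- f \<odot> ?w"
      have "f \<in> V" using f F(2) by auto
      then have "?u \<in> V \<inter> hcball G 0 b"
        using f w by (auto simp: Viff inner_mult[OF n] d_0 hom_dist_def)
      then have uD: "h \<odot> ?u \<odot> - h \<in> ?D" by blast
      then obtain i where i: "i \<in> I" "h \<odot> ?u \<odot> - h \<in> C i" using C(2) by blast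
      then have iJ: "i \<in> J" using uD by (auto simp: J_def)
      have "ennreal (d (c i) (h \<odot> ?u \<odot> - h)) \<le> ennreal (e i)"
        using hdiam_ge[OF c(1)[OF iJ] i(2)] e[OF iJ] by simp
      then have "d (c i) (h \<odot> ?u \<odot> - h) \<le> e i"
        using e0 by (simp add: ennreal_le_iff)
      moreover have cancel: "x \<odot> (- x \<odot> y) = y" "- x \<odot> (x \<odot> y) = y" for x y
        by (simp_all add: assoc[symmetric])
      have "(h \<odot> f \<odot> - h) \<odot> (h \<odot> ?u \<odot> - h) = w"
        by (simp add: assoc cancel)
      ultimately have "d (h \<odot> f \<odot> - h \<odot> c i) w \<le> e i"
        by (metis d_left)
      then have "w \<in> B f i" using w iJ by (simp add: B_def)
      with f show "w \<in> (\<Union>f\<in>F. \<Union>i. B f i)" by blast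
    qed
    then have "emeasure ?M (V \<inter> hcball G 0 (R / 2)) \<le> emeasure ?M (\<Union>f\<in>F. \<Union>i. B f i)"
      using B_meas F(1) by (intro emeasure_mono sets.finite_UN sets.countable_UN) auto
    also have "\<dots> \<le> (\<Sum>f\<in>F. emeasure ?M (\<Union>i. B f i))"
      using B_meas F(1) by (intro emeasure_subadditive_finite) (auto intro!: sets.countable_UN)
    also have "\<dots> \<le> (\<Sum>f\<in>F. \<Sum>i. emeasure ?M (B f i))"
      using B_meas by (intro sum_mono emeasure_subadditive_countably) auto
    also have "\<dots> \<le> (\<Sum>f\<in>F. \<Sum>i. (if i \<in> I then (hdiam G (C i) / 2) ^ m else 0) * (ennreal (2 ^ m) * ?k))"
      using B_le by (intro sum_mono suminf_le) auto
    also have "\<dots> = of_nat (card F) * ((\<Sum>i. if i \<in> I then (hdiam G (C i) / 2) ^ m else 0) * (ennreal (2 ^ m) * ?k))"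
      by (simp only: ennreal_suminf_multc sum_constant)
    also have "\<dots> \<le> ennreal ((6 * R / b) ^ m) * ((\<Sum>i. if i \<in> I then (hdiam G (C i) / 2) ^ m else 0) * (ennreal (2 ^ m) * ?k))"
      using F(3) by (intro mult_right_mono) (simp_all add: ennreal_of_nat_eq_real_of_nat ennreal_leI)
    finally have "?k * ennreal ((R / 2) ^ m) \<le>
        ?k * (ennreal ((6 * R / b) ^ m) * (ennreal (2 ^ m) * (\<Sum>i. if i \<in> I then (hdiam G (C i) / 2) ^ m else 0)))"
      using emeasure_regular_ball[OF V V0, of "R / 2"] R(3) by (simp only: ac_simps)
    then have "ennreal ((R / 2) ^ m) \<le>
        ennreal ((6 * R / b) ^ m) * (ennreal (2 ^ m) * (\<Sum>i. if i \<in> I then (hdiam G (C i) / 2) ^ m else 0))"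
      unfolding ennreal_mult_le_mult_iff[OF k] .
    also have "\<dots> = ennreal ((12 * R / b) ^ m) * (\<Sum>i. if i \<in> I then (hdiam G (C i) / 2) ^ m else 0)"
      using b R(3) by (simp add: mult.assoc[symmetric] ennreal_mult'[symmetric] power_mult_distrib[symmetric])
    finally have le: "ennreal ((R / 2) ^ m) \<le> \<dots>" .
    \<comment> \<open>The factor \<open>12\<close> is \<open>6\<close> from the cardinality bound
      times \<open>2\<close> from the halved diameters in \<open>haus\<close>; dividing
      \<open>R / 2\<close> by \<open>12 * R / b\<close> leaves \<open>b / 24\<close>.\<close>
    have eq: "ennreal ((R / 2) ^ m) = ennreal ((12 * R / b) ^ m) * ennreal ((b / 24) ^ m)"
      using b R(3) by (simp add: ennreal_mult'[symmetric] power_mult_distrib[symmetric])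
    show ?thesis
      using le b R(3) unfolding eq by (simp add: ennreal_mult_le_mult_iff)
  qed
  have "ennreal ((b / 24) ^ m) \<le> (INF (I, C)\<in>{(I :: nat set, C).
         (\<forall>i\<in>I. hdiam G (C i) \<le> ennreal 1) \<and> ?D \<subseteq> (\<Union>i\<in>I. C i)}.
       (\<Sum>i. if i \<in> I then (hdiam G (C i) / 2) ^ m else 0))"
    using cost by (intro INF_greatest) auto
  also have "\<dots> \<le> haus m ?D"
    unfolding hausdorff_outer_def by (intro SUP_upper[of 1]) simp
  finally show ?thesis .
qed

end


section \<open>Flat distances\<close>

context carnot_grp
begin

section \<open>Tent functions as test functions\<close>

definition bump :: "'a \<Rightarrow> real \<Rightarrow> 'a \<Rightarrow> real" where
  "bump c t y = max 0 (t - d c y)"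

lemma bump_test_function:
  assumes "d x c + t \<le> r"
  shows "bump c t \<in> test_functions G x r"
proof -
  have "\<bar>bump c t y - bump c t z\<bar> \<le> d y z" for y z
    using d_tri[of c y z] d_tri[of c z y] d_comm[of y z] by (simp add: bump_def)
  moreover have "{y. bump c t y \<noteq> 0} \<subseteq> hball G x r"
  proof
    fix y assume "y \<in> {y. bump c t y \<noteq> 0}"
    then show "y \<in> hball G x r"
      using d_tri[of x y c] assms by (auto simp: bump_def max_def split: if_splits)
  qed
  ultimately show ?thesis
    by (auto simp: test_functions_def bump_def intro!: closure_mono)
qed

lemma borel_measurable_bump [measurable]: "bump c t \<in> borel_measurable borel"
  unfolding bump_def[abs_def] by measurable

lemma bump_bounds: "0 \<le> bump c t y" "bump c t y \<le> t * indicator (hball G c t) y"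
proof -
  have "0 \<le> d c y" by simp
  then show "bump c t y \<le> t * indicator (hball G c t) y"
    by (cases "d c y < t") (auto simp: bump_def simp del: metr.nonneg)
qed (simp add: bump_def)

lemma integrable_bump:
  assumes "sets \<nu> = sets borel" "emeasure \<nu> (hball G c t) < \<infinity>"
  shows "integrable \<nu> (bump c t)"
proof (rule integrableI_bounded_set)
  show "hball G c t \<in> sets \<nu>" "bump c t \<in> borel_measurable \<nu>"
    using assms(1) measurable_cong_sets[OF assms(1) refl, of borel] by auto
  show "AE x in \<nu>. x \<in> hball G c t \<longrightarrow> norm (bump c t x) \<le> t"
    using bump_bounds[of c t] by (intro AE_I2) (auto simp: bump_def)
  show "AE x in \<nu>. x \<notin> hball G c t \<longrightarrow> bump c t x = 0"
    by (intro AE_I2) (simp add: bump_def)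
qed (rule assms)

lemma integral_bump_le:
  assumes "sets \<nu> = sets borel" "emeasure \<nu> (hball G c t) < \<infinity>"
  shows "integral\<^sup>L \<nu> (bump c t) \<le> t * measure \<nu> (hball G c t)"
proof -
  have "integral\<^sup>L \<nu> (bump c t) \<le> integral\<^sup>L \<nu> (\<lambda>y. t * indicator (hball G c t) y)"
    using assms integrable_bump[OF assms] bump_bounds
    by (intro integral_mono) (auto intro!: integrable_mult_right)
  then show ?thesis
    using sets.sets_into_space[of "hball G c t" \<nu>] assms(1) by (simp add: inf_absorb1)
qed

text \<open>The bump is at least \<open>t / 2\<close> on the ball of half the radius. The second
  conclusion turns integrability into finiteness, which later bounds the spherical measure of the
  unit ball of a plane.\<close>

lemma integral_bump_ge:
  assumes "sets \<nu> = sets borel" "0 < t" "integrable \<nu> (bump c t)"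
    and A: "A \<in> sets borel" "A \<subseteq> hcball G c (t / 2)" "ennreal K \<le> emeasure \<nu> A"
  shows "t / 2 * K \<le> integral\<^sup>L \<nu> (bump c t)"
    and "emeasure \<nu> A < \<infinity>"
proof -
  have "ennreal (t / 2) * emeasure \<nu> A = (\<integral>\<^sup>+ y. ennreal (t / 2) * indicator A y \<partial>\<nu>)"
    using assms(1) A(1) by (subst nn_integral_cmult_indicator) auto
  also have "\<dots> \<le> (\<integral>\<^sup>+ y. ennreal (bump c t y) \<partial>\<nu>)"
    using A(2) assms(2) by (intro nn_integral_mono) (auto simp: bump_def indicator_def intro!: ennreal_leI)
  also have "\<dots> = ennreal (integral\<^sup>L \<nu> (bump c t))"
    using assms(3) bump_bounds by (intro nn_integral_eq_integral) auto
  finally have le: "ennreal (t / 2) * emeasure \<nu> A \<le> ennreal (integral\<^sup>L \<nu> (bump c t))" .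
  have "ennreal (t / 2) * emeasure \<nu> A < top"
    using le_less_trans[OF le ennreal_less_top] .
  then show "emeasure \<nu> A < \<infinity>"
    using assms(2) by (auto simp: ennreal_mult_less_top)
  have "ennreal (t / 2 * K) = ennreal (t / 2) * ennreal K"
    using assms(2) by (intro ennreal_mult') simp
  also have "\<dots> \<le> ennreal (t / 2) * emeasure \<nu> A"
    using A(3) by (intro mult_left_mono) auto
  also note le
  finally show "t / 2 * K \<le> integral\<^sup>L \<nu> (bump c t)"
    using bump_bounds by (subst (asm) ennreal_le_iff) (auto intro!: integral_nonneg_AE)
qed

section \<open>From small flat distance to bilateral flatness\<close>

lemma flat_distanceD:
  assumes "flat_distance G x r \<phi> < ennreal \<delta>" "0 < r"
  obtains \<Theta> V where "0 < \<Theta>" "V \<in> Gr G"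
    "\<And>f. f \<in> test_functions G x r \<Longrightarrow>
      \<bar>integral\<^sup>L \<phi> f - integral\<^sup>L (scale_measure (ennreal \<Theta>)
          (measure_restriction (spherical_measure G (hom_dim G - 1)) ((\<odot>) x ` V))) f\<bar>
        < \<delta> * r ^ hom_dim G"
proof -
  obtain \<Theta> V where V: "0 < \<Theta>" "V \<in> Gr G"
    and lt: "F_dist G x r \<phi> (scale_measure (ennreal \<Theta>)
          (measure_restriction (spherical_measure G (hom_dim G - 1)) ((\<odot>) x ` V)))
        / ennreal (r ^ hom_dim G) < ennreal \<delta>"
    using assms(1) unfolding flat_distance_def INF_less_iff by auto
  have \<delta>: "0 \<le> \<delta>"
    by (rule ccontr) (use lt in \<open>simp add: ennreal_neg\<close>)
  let ?\<psi> = "scale_measure (ennreal \<Theta>)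
          (measure_restriction (spherical_measure G (hom_dim G - 1)) ((\<odot>) x ` V))"
  have F: "F_dist G x r \<phi> ?\<psi> < ennreal (\<delta> * r ^ hom_dim G)"
    using lt assms(2) \<delta> by (subst (asm) divide_less_ennreal) (auto simp: ennreal_mult)
  have "\<bar>integral\<^sup>L \<phi> f - integral\<^sup>L ?\<psi> f\<bar> < \<delta> * r ^ hom_dim G" if "f \<in> test_functions G x r" for f
  proof -
    have "ennreal \<bar>integral\<^sup>L \<phi> f - integral\<^sup>L ?\<psi> f\<bar> \<le> F_dist G x r \<phi> ?\<psi>"
      unfolding F_dist_def using that by (rule SUP_upper)
    then have "ennreal \<bar>integral\<^sup>L \<phi> f - integral\<^sup>L ?\<psi> f\<bar> < ennreal (\<delta> * r ^ hom_dim G)"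
      using F by (rule le_less_trans)
    then show ?thesis by (simp add: ennreal_less_iff)
  qed
  with V show thesis using that by blast
qed

text \<open>The difference of normal coordinates is exactly the distance of \<open>y\<close> from
  the coset of \<open>V\<close> through \<open>x\<close>, since moving along the normal line
  realises it.\<close>

definition flat_at :: "'a set \<Rightarrow> real \<Rightarrow> 'a \<Rightarrow> real \<Rightarrow> 'a set \<Rightarrow> bool" where
  "flat_at E \<epsilon> x r V \<longleftrightarrow> V \<in> Gr G \<and>
     (\<forall>y\<in>E. d x y \<le> r \<longrightarrow> \<bar>y \<bullet> plane_normal G V - x \<bullet> plane_normal G V\<bar> \<le> \<epsilon> * r) \<and>
     (\<forall>v\<in>V. hnorm v \<le> r \<longrightarrow> (\<exists>e\<in>E. d e (x \<odot> v) \<le> \<epsilon> * r))"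

text \<open>If a point of \<open>E\<close> had no point of the coset within
  \<open>\<epsilon> * r\<close>, the bump of that radius there would see \<open>E\<close> but not
  the coset; a point of the coset far from \<open>E\<close> gives the reverse situation. Either
  discrepancy is too large for the flat distance at radius \<open>2 * r\<close>. The second case
  needs a lower bound for the density of the flat measure, obtained from the bump at
  \<open>x\<close> itself.\<close>

lemma flat_distance_imp_flat_at:
  defines "m \<equiv> hom_dim G - 1"
  assumes E: "E \<in> sets borel"
    and H: "emeasure (hausdorff_measure G m) A \<noteq> 0"
    and \<eta>: "0 < \<eta>"
    and lower: "\<And>x r. \<lbrakk>x \<in> E; 0 < r; r < R\<rbrakk> \<Longrightarrow> ennreal (1 / \<eta> * r ^ m) \<le> haus m (E \<inter> hball G x r)"
    and upper: "\<And>x r. \<lbrakk>x \<in> E; 0 < r; r < R\<rbrakk> \<Longrightarrow> haus m (E \<inter> hball G x r) \<le> ennreal (\<eta> * r ^ m)"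
    and \<epsilon>: "0 < \<epsilon>" "\<epsilon> \<le> 1"
    and x: "x \<in> E" and r: "0 < r" "2 * r < R"
    and flat: "flat_distance G x (2 * r) (measure_restriction (hausdorff_measure G m) E)
       < ennreal (1 / \<eta> * (\<epsilon> / 4) ^ hom_dim G / 2 ^ (hom_dim G + 1))"
  shows "\<exists>V. regular_plane m V \<and> flat_at E \<epsilon> x r V"
proof -
  let ?Q = "hom_dim G" and ?c = "1 / \<eta>"
  let ?M = "hausdorff_measure G m" and ?S = "spherical_measure G m"
  define \<phi> where "\<phi> = measure_restriction ?M E"
  define \<delta> where "\<delta> = ?c * (\<epsilon> / 4) ^ ?Q / 2 ^ (?Q + 1)"
  obtain \<Theta> V where \<Theta>: "0 < \<Theta>" and V: "V \<in> Gr G"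
    and close: "\<And>f. f \<in> test_functions G x (2 * r) \<Longrightarrow>
      \<bar>integral\<^sup>L \<phi> f - integral\<^sup>L (scale_measure (ennreal \<Theta>) (measure_restriction ?S ((\<odot>) x ` V))) f\<bar>
        < \<delta> * (2 * r) ^ ?Q"
    using flat r(1) flat_distanceD[of x "2 * r" \<phi> \<delta>] unfolding \<phi>_def \<delta>_def m_def by auto
  define \<psi> where "\<psi> = scale_measure (ennreal \<Theta>) (measure_restriction ?S ((\<odot>) x ` V))"
  note close = close[folded \<psi>_def]
  have Q: "?Q = Suc m"
    using hom_dim_pos[OF V] by (simp add: m_def)
  have sets: "sets \<phi> = sets borel" "sets \<psi> = sets borel"
    by (simp_all add: \<phi>_def \<psi>_def measure_restriction_def)
  have \<phi>: "emeasure \<phi> B = haus m (E \<inter> B)" if "B \<in> sets borel" for B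
    using that E emeasure_hausdorff[OF H] by (simp add: \<phi>_def measure_restriction_def emeasure_restricted)
  have \<psi>: "emeasure \<psi> B = ennreal \<Theta> * emeasure ?S ((\<odot>) x ` V \<inter> B)" if "B \<in> sets borel" for B
    using that borel_coset[OF V] by (simp add: \<psi>_def measure_restriction_def emeasure_restricted)
  have \<phi>_ge: "t / 2 * (?c * (t / 2) ^ m) \<le> integral\<^sup>L \<phi> (bump y t)"
    if y: "y \<in> E" and t: "0 < t" "t < R" for y t
  proof (rule integral_bump_ge(1)[OF sets(1) t(1)])
    have "emeasure \<phi> (hball G y t) \<le> ennreal (\<eta> * t ^ m)"
      using upper[OF y t] by (simp add: \<phi>)
    also have "\<dots> < \<infinity>" by simp
    finally show "integrable \<phi> (bump y t)"
      by (intro integrable_bump sets)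
    show "ennreal (?c * (t / 2) ^ m) \<le> emeasure \<phi> (hball G y (t / 2))"
      using lower[OF y, of "t / 2"] t by (simp add: \<phi>)
  qed auto
  have null: "integral\<^sup>L \<nu> (bump y t) \<le> 0"
    if "sets \<nu> = sets borel" "emeasure \<nu> (hball G y t) = 0" for \<nu> y t
    using integral_bump_le[OF that(1), of y t] that(2) by (simp add: measure_def)
  have c: "0 < ?c" using \<eta> by simp
  \<comment> \<open>The first bound serves small bumps centred on \<open>E\<close>, the second the
    bump of radius \<open>2 * r\<close> at \<open>x\<close>.\<close>
  have \<delta>: "\<delta> \<le> ?c * (\<epsilon> / 4) ^ ?Q" "\<delta> \<le> ?c / 2 ^ (?Q + 1)"
  proof -
    have "(1::real) \<le> 2 ^ (?Q + 1)" by (rule one_le_power) simp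
    then show "\<delta> \<le> ?c * (\<epsilon> / 4) ^ ?Q"
      unfolding \<delta>_def using c \<epsilon> by (simp add: pos_divide_le_eq mult_le_cancel_left1 del: power_Suc)
    have "(\<epsilon> / 4) ^ ?Q \<le> 1" using \<epsilon> by (intro power_le_one) auto
    then show "\<delta> \<le> ?c / 2 ^ (?Q + 1)"
      unfolding \<delta>_def using c by (intro divide_right_mono mult_left_le) auto
  qed
  \<comment> \<open>The permitted error is at most half of the lower regularity bound for the large
    bump at \<open>x\<close>, so the flat measure retains the other half.\<close>
  define I where "I = integral\<^sup>L \<psi> (bump x (2 * r))"
  have "?c * r ^ ?Q \<le> integral\<^sup>L \<phi> (bump x (2 * r))"
    using \<phi>_ge[OF x, of "2 * r"] r by (simp add: Q mult.left_commute)
  moreover have "\<bar>integral\<^sup>L \<phi> (bump x (2 * r)) - I\<bar> < \<delta> * (2 * r) ^ ?Q"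
    unfolding I_def using r by (intro close bump_test_function) auto
  moreover have "\<delta> * (2 * r) ^ ?Q \<le> ?c / 2 ^ (?Q + 1) * (2 * r) ^ ?Q"
    using \<delta>(2) r by (intro mult_right_mono) auto
  moreover have "?c / 2 ^ (?Q + 1) * (2 * r) ^ ?Q = ?c * r ^ ?Q / 2"
    by (simp add: power_mult_distrib power_add)
  ultimately have I: "?c * r ^ ?Q / 2 \<le> I" by linarith
  moreover have "0 < ?c * r ^ ?Q / 2" using c r by simp
  ultimately have I0: "0 < I" by linarith
  \<comment> \<open>A non-integrable function has integral \<open>0\<close> by default, so
    \<open>I0\<close> already yields integrability, and with it \<open>\<kappa> < top\<close>.
    Likewise \<open>ne\<close> shows that \<open>spherical_measure\<close> is not the null
    default.\<close>
  have int: "integrable \<psi> (bump x (2 * r))"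
    using I0 not_integrable_integral_eq[of \<psi> "bump x (2 * r)"] unfolding I_def by force
  have ne: "emeasure \<psi> (hball G x (2 * r)) \<noteq> 0"
    using null[OF sets(2), of x "2 * r"] I0 unfolding I_def by force
  then have "emeasure ?S ((\<odot>) x ` V \<inter> hball G x (2 * r)) \<noteq> 0"
    using \<psi>[of "hball G x (2 * r)"] by auto
  note S = emeasure_spherical[OF this]
  define \<kappa> where "\<kappa> = sph m (V \<inter> hcball G 0 1)"
  have \<psi>_ball: "emeasure \<psi> (hcball G (x \<odot> v) t) = ennreal \<Theta> * (ennreal (t ^ m) * \<kappa>)"
    if "v \<in> V" "0 < t" for v t
    using S borel_coset[OF V] spherical_plane_ball[OF V that, of m x] by (simp add: \<psi> \<kappa>_def)
  have \<psi>_ball0: "emeasure \<psi> (hcball G x t) = ennreal \<Theta> * (ennreal (t ^ m) * \<kappa>)" if "0 < t" for t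
    using \<psi>_ball[OF Gr_zero[OF V] that] by simp
  have \<psi>_le: "emeasure \<psi> (hball G y t) \<le> emeasure \<psi> (hcball G y t)" for y t
    using sets(2) by (intro emeasure_mono) auto
  have "\<kappa> \<noteq> 0"
    using ne \<psi>_le[of x "2 * r"] \<psi>_ball0[of "2 * r"] r by auto
  have "emeasure \<psi> (hcball G x r) < \<infinity>"
    using integral_bump_ge(2)[OF sets(2) _ int, of "hcball G x r" 0] r by simp
  then have "\<kappa> < top"
    using \<Theta> r by (auto simp: \<psi>_ball0 ennreal_mult_less_top)
  define k where "k = enn2real \<kappa>"
  have k: "\<kappa> = ennreal k" "0 < k"
    using \<open>\<kappa> < top\<close> \<open>\<kappa> \<noteq> 0\<close> by (auto simp: k_def enn2real_positive_iff zero_less_iff_neq_zero)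
  have \<psi>_ball_k: "emeasure \<psi> (hcball G (x \<odot> v) t) = ennreal (\<Theta> * k * t ^ m)" if "v \<in> V" "0 < t" for v t
    using \<psi>_ball[OF that] \<Theta> k that by (simp add: ennreal_mult' ac_simps)
  have "regular_plane m V"
    using V S borel_plane[OF V] k by (simp add: regular_plane_def flip: \<kappa>_def)
  have \<psi>_fin: "emeasure \<psi> (hball G (x \<odot> v) t) < \<infinity>" if "v \<in> V" "0 < t" for v t
    using \<psi>_le[of "x \<odot> v" t] \<psi>_ball_k[OF that] by (simp add: le_less_trans)
  \<comment> \<open>An upper bound for \<open>I\<close> by the mass of the ball, which together with
    \<open>I\<close> from below bounds the density \<open>\<Theta> * k\<close> from below.\<close>
  have "I \<le> 2 * r * measure \<psi> (hball G x (2 * r))"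
    unfolding I_def using \<psi>_fin[OF Gr_zero[OF V], of "2 * r"] r by (intro integral_bump_le sets) simp
  also have "measure \<psi> (hball G x (2 * r)) \<le> \<Theta> * k * (2 * r) ^ m"
    using \<psi>_le[of x "2 * r"] \<psi>_ball_k[OF Gr_zero[OF V], of "2 * r"] r \<Theta> k
    by (auto simp: measure_def intro!: enn2real_leI)
  finally have "I \<le> \<Theta> * k * (2 * r) ^ ?Q"
    using r by (simp add: Q mult_left_mono ac_simps)
  with I have "?c / 2 * r ^ ?Q \<le> (\<Theta> * k * 2 ^ ?Q) * r ^ ?Q"
    by (simp add: power_mult_distrib ac_simps)
  then have "?c / 2 \<le> \<Theta> * k * 2 ^ ?Q"
    using r by (subst (asm) mult_le_cancel_right_pos) auto
  then have "?c / 2 / 2 ^ ?Q \<le> \<Theta> * k"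
    by (subst pos_divide_le_eq) auto
  then have \<Theta>k: "?c / 2 ^ (?Q + 1) \<le> \<Theta> * k"
    by (simp add: power_add ac_simps)
  have \<epsilon>r: "0 < \<epsilon> * r" "\<epsilon> * r \<le> r" using \<epsilon> r by (auto simp: mult_le_cancel_right1)
  have half: "\<epsilon> * r / 2 * (\<epsilon> * r / 2) ^ m = (\<epsilon> / 4) ^ ?Q * (2 * r) ^ ?Q"
  proof -
    have "\<epsilon> * r / 2 = \<epsilon> / 4 * (2 * r)" by simp
    then show ?thesis unfolding power_mult_distrib[symmetric] Q power_Suc[symmetric] by (rule arg_cong)
  qed
  have "\<bar>y \<bullet> plane_normal G V - x \<bullet> plane_normal G V\<bar> \<le> \<epsilon> * r" if y: "y \<in> E" "d x y \<le> r" for y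
  proof (cases "(\<odot>) x ` V \<inter> hball G y (\<epsilon> * r) = {}")
    case True
    then have "integral\<^sup>L \<psi> (bump y (\<epsilon> * r)) \<le> 0"
      by (intro null sets) (simp add: \<psi>)
    moreover have "?c * (\<epsilon> / 4) ^ ?Q * (2 * r) ^ ?Q = \<epsilon> * r / 2 * (?c * (\<epsilon> * r / 2) ^ m)"
      unfolding mult.assoc half[symmetric] by (rule mult.left_commute)
    moreover have "\<epsilon> * r / 2 * (?c * (\<epsilon> * r / 2) ^ m) \<le> integral\<^sup>L \<phi> (bump y (\<epsilon> * r))"
      using \<epsilon>r r by (intro \<phi>_ge[OF y(1)]) linarith+
    moreover have "\<bar>integral\<^sup>L \<phi> (bump y (\<epsilon> * r)) - integral\<^sup>L \<psi> (bump y (\<epsilon> * r))\<bar> < \<delta> * (2 * r) ^ ?Q"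
      using y \<epsilon>r by (intro close bump_test_function) linarith
    moreover have "\<delta> * (2 * r) ^ ?Q \<le> ?c * (\<epsilon> / 4) ^ ?Q * (2 * r) ^ ?Q"
      using \<delta>(1) r by (intro mult_right_mono) auto
    ultimately show ?thesis by linarith
  next
    case False
    then obtain v where v: "v \<in> V" "d y (x \<odot> v) < \<epsilon> * r" by auto
    have "(x \<odot> v) \<bullet> plane_normal G V = x \<bullet> plane_normal G V"
      using v(1) by (simp add: inner_mult[OF plane_normal_hor[OF V]] plane_iff[OF V])
    then show ?thesis
      using v(2) abs_inner_diff_le[OF plane_normal_hor[OF V], of "x \<odot> v" y] norm_plane_normal[OF V]
        d_comm[of y "x \<odot> v"] by simp
  qed
  moreover have "\<exists>e\<in>E. d e (x \<odot> v) \<le> \<epsilon> * r" if v: "v \<in> V" "hnorm v \<le> r" for v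
  proof (cases "E \<inter> hball G (x \<odot> v) (\<epsilon> * r) = {}")
    case True
    have "emeasure \<phi> (hball G (x \<odot> v) (\<epsilon> * r)) = haus m {}"
      using True by (simp add: \<phi>)
    also have "haus m {} = emeasure ?M {}"
      using emeasure_hausdorff[OF H, of "{}"] by simp
    finally have "integral\<^sup>L \<phi> (bump (x \<odot> v) (\<epsilon> * r)) \<le> 0"
      by (intro null sets) simp
    moreover have "\<epsilon> * r / 2 * (\<Theta> * k * (\<epsilon> * r / 2) ^ m) \<le> integral\<^sup>L \<psi> (bump (x \<odot> v) (\<epsilon> * r))"
    proof (rule integral_bump_ge(1)[OF sets(2) \<epsilon>r(1)])
      show "integrable \<psi> (bump (x \<odot> v) (\<epsilon> * r))"
        by (intro integrable_bump sets \<psi>_fin v \<epsilon>r)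
      show "ennreal (\<Theta> * k * (\<epsilon> * r / 2) ^ m) \<le> emeasure \<psi> (hcball G (x \<odot> v) (\<epsilon> * r / 2))"
        using \<epsilon>r v by (simp add: \<psi>_ball_k)
    qed auto
    moreover have "\<epsilon> * r / 2 * (\<Theta> * k * (\<epsilon> * r / 2) ^ m) = \<Theta> * k * ((\<epsilon> / 4) ^ ?Q * (2 * r) ^ ?Q)"
      unfolding half[symmetric] by simp
    moreover have "\<bar>integral\<^sup>L \<phi> (bump (x \<odot> v) (\<epsilon> * r)) - integral\<^sup>L \<psi> (bump (x \<odot> v) (\<epsilon> * r))\<bar> < \<delta> * (2 * r) ^ ?Q"
      using v \<epsilon>r d_mult[of x v] by (intro close bump_test_function) linarith
    moreover have "\<delta> * (2 * r) ^ ?Q \<le> \<Theta> * k * ((\<epsilon> / 4) ^ ?Q * (2 * r) ^ ?Q)"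
    proof -
      have "\<delta> = ?c / 2 ^ (?Q + 1) * (\<epsilon> / 4) ^ ?Q" by (simp add: \<delta>_def)
      also have "\<dots> \<le> \<Theta> * k * (\<epsilon> / 4) ^ ?Q"
        using \<Theta>k \<epsilon> by (intro mult_right_mono) auto
      finally have "\<delta> * (2 * r) ^ ?Q \<le> \<Theta> * k * (\<epsilon> / 4) ^ ?Q * (2 * r) ^ ?Q"
        using r by (intro mult_right_mono) auto
      then show ?thesis by (simp add: mult.assoc)
    qed
    ultimately show ?thesis by linarith
  next
    case False
    then obtain e where "e \<in> E" "d (x \<odot> v) e < \<epsilon> * r" by auto
    then show ?thesis using d_comm[of e "x \<odot> v"] by (intro bexI[of _ e]) auto
  qed
  ultimately show ?thesis
    using \<open>regular_plane m V\<close> V unfolding flat_at_def by blast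
qed

end


section \<open>Vertical lines meet flat sets\<close>

lemma inner_nonneg_if_close:
  fixes a b :: "'a::real_inner"
  assumes "norm a = 1" "norm b = 1" "norm (a - b) \<le> 1"
  shows "0 \<le> a \<bullet> b"
proof -
  have "(norm (a - b))\<^sup>2 = 2 - 2 * (a \<bullet> b)"
    using assms(1,2) by (simp add: power2_norm_eq_inner inner_diff_left inner_diff_right inner_commute norm_eq_1)
  moreover have "(norm (a - b))\<^sup>2 \<le> 1"
    using assms(3) by (simp add: power_le_one)
  ultimately show ?thesis by linarith
qed

text \<open>Flatness at the dyadic scales is all that the argument with sides uses; \<open>P\<close>
  fixes one plane per point and scale. The constant \<open>1 / 10000\<close> is small enough for
  tilts of at most \<open>1 / 20\<close> between comparable planes.\<close>

locale flat_family = carnot_grp +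
  fixes E :: "'a set" and x :: 'a and \<rho> :: real and P :: "'a \<Rightarrow> nat \<Rightarrow> 'a set"
  assumes compact: "compact E" and x: "x \<in> E" and \<rho>: "0 < \<rho>"
    and flat: "p \<in> E \<Longrightarrow> flat_at E (1 / 10000) p (\<rho> / 2 ^ k) (P p k)"
begin

section \<open>Oriented normals at dyadic scales\<close>

definition s :: "nat \<Rightarrow> real" where "s k = \<rho> / 2 ^ k"

lemma flat_s: "p \<in> E \<Longrightarrow> flat_at E (1 / 10000) p (s k) (P p k)"
  unfolding s_def by (rule flat)

lemma s_simps: "0 < s k" "s (Suc k) = s k / 2" "s 0 = \<rho>"
  using \<rho> by (auto simp: s_def)

abbreviation nrm :: "'a \<Rightarrow> nat \<Rightarrow> 'a" where "nrm p k \<equiv> plane_normal G (P p k)"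

text \<open>The normals are oriented by descending through the scales, starting from the normal at \<open>x\<close>.\<close>

primrec orient :: "'a \<Rightarrow> nat \<Rightarrow> 'a" where
  "orient p 0 = (if 0 \<le> nrm p 0 \<bullet> nrm x 0 then nrm p 0 else - nrm p 0)"
| "orient p (Suc k) = (if 0 \<le> nrm p (Suc k) \<bullet> orient p k then nrm p (Suc k) else - nrm p (Suc k))"

lemma orient_cases: "orient p k = nrm p k \<or> orient p k = - nrm p k"
  by (cases k) auto

lemma orient_x: "orient x 0 = nrm x 0"
  by simp

lemma plane_P: "p \<in> E \<Longrightarrow> P p k \<in> Gr G"
  using flat by (simp add: flat_at_def)

lemma orient_hor: "p \<in> E \<Longrightarrow> orient p k \<in> hor"
  using orient_cases[of p k] plane_normal_hor[OF plane_P, of p k] subspace_neg[OF hor_subspace] by metis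

lemma norm_orient: "p \<in> E \<Longrightarrow> norm (orient p k) = 1"
  using orient_cases[of p k] norm_plane_normal[OF plane_P, of p k] by (metis norm_minus_cancel)

lemma orient_flat:
  assumes "p \<in> E" "y \<in> E" "d p y \<le> s k"
  shows "\<bar>y \<bullet> orient p k - p \<bullet> orient p k\<bar> \<le> s k / 10000"
proof -
  have "\<bar>y \<bullet> nrm p k - p \<bullet> nrm p k\<bar> \<le> s k / 10000"
    using flat_s[OF assms(1), of k] assms(2,3) by (simp add: flat_at_def)
  then show ?thesis
    using orient_cases[of p k] by (auto simp: abs_minus_commute)
qed

lemma orient_full:
  assumes "p \<in> E" "v \<bullet> orient p k = 0" "hnorm v \<le> s k"
  shows "\<exists>e\<in>E. d e (p \<odot> v) \<le> s k / 10000"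
proof -
  have "v \<in> P p k"
    using assms(2) orient_cases[of p k] plane_iff[OF plane_P[OF assms(1)]] by auto
  then show ?thesis
    using flat_s[OF assms(1), of k] assms(3) by (simp add: flat_at_def)
qed

text \<open>Let \<open>u\<close> be the part of the first normal orthogonal to the second. Moving
  from \<open>q\<close> along \<open>u\<close> stays in the coset at \<open>q\<close>, so it ends
  near a point of \<open>E\<close>, which lies in the slab at \<open>p\<close>. The first normal
  coordinate grows by a multiple of \<open>1 - ?c\<^sup>2\<close>, which must therefore be small.
  The sign assumption rules out nearly opposite normals.\<close>

lemma orient_close:
  assumes p: "p \<in> E" and q: "q \<in> E" and j: "j = k \<or> j = Suc k" and pq: "d p q \<le> s k / 4"
    and pos: "0 \<le> orient p k \<bullet> orient q j"
  shows "norm (orient p k - orient q j) \<le> 1 / 20"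
proof -
  let ?n = "orient p k" and ?n' = "orient q j"
  let ?c = "?n \<bullet> ?n'"
  note hor = orient_hor[OF p, of k] orient_hor[OF q, of j]
  note norm = norm_orient[OF p, of k] norm_orient[OF q, of j]
  have nn: "?n \<bullet> ?n = 1" "?n' \<bullet> ?n' = 1" using norm by (simp_all add: dot_square_norm)
  have sj: "s k / 2 \<le> s j" "s j \<le> s k" using j s_simps(1,2)[of k] by auto
  define u where "u = ?n - ?c *\<^sub>R ?n'"
  have u_hor: "u \<in> hor"
    unfolding u_def using hor hor_subspace by (intro subspace_diff subspace_scale)
  have un: "u \<bullet> ?n' = 0" "u \<bullet> ?n = 1 - ?c\<^sup>2"
    using nn by (simp_all add: u_def inner_simps power2_eq_square inner_commute)
  have "u \<bullet> u = 1 - ?c\<^sup>2"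
    using un by (simp add: u_def inner_diff_right)
  then have "(norm u)\<^sup>2 \<le> 1\<^sup>2" by (simp add: power2_norm_eq_inner)
  then have u1: "norm u \<le> 1"
    by (rule power2_le_imp_le) simp
  let ?v = "(s k / 4) *\<^sub>R u"
  have "?v \<in> hor" using u_hor hor_subspace by (intro subspace_scale)
  then have v: "hnorm ?v \<le> s k / 4"
    using u1 s_simps(1)[of k] mult_left_mono[OF u1, of "s k / 4"] by (simp add: hnorm_hor)
  have "?v \<bullet> ?n' = 0" using un(1) by simp
  then obtain e where e: "e \<in> E" "d e (q \<odot> ?v) \<le> s j / 10000"
    using orient_full[OF q, of ?v j] v sj s_simps(1)[of k] by force
  have "d p e \<le> d p q + d q (q \<odot> ?v) + d (q \<odot> ?v) e"
    using d_tri[of p e "q \<odot> ?v"] d_tri[of p "q \<odot> ?v" q] by linarith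
  then have "d p e \<le> s k"
    using pq v e(2) sj s_simps(1)[of k] d_comm[of e "q \<odot> ?v"] d_mult[of q ?v] by linarith
  then have "\<bar>e \<bullet> ?n - p \<bullet> ?n\<bar> \<le> s k / 10000"
    by (rule orient_flat[OF p e(1)])
  moreover have "\<bar>q \<bullet> ?n - p \<bullet> ?n\<bar> \<le> s k / 10000"
    using pq s_simps(1)[of k] by (intro orient_flat[OF p q]) linarith
  moreover have "\<bar>(q \<odot> ?v) \<bullet> ?n - e \<bullet> ?n\<bar> \<le> s j / 10000"
    using abs_inner_diff_le[OF hor(1), of "q \<odot> ?v" e] e(2) norm by simp
  moreover have "(q \<odot> ?v) \<bullet> ?n = q \<bullet> ?n + s k / 4 * (1 - ?c\<^sup>2)"
    using un(2) by (simp add: inner_mult[OF hor(1)])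
  \<comment> \<open>Three flatness errors of at most \<open>s k / 10000\<close> against the
    displacement \<open>s k / 4\<close>.\<close>
  ultimately have "s k / 4 * (1 - ?c\<^sup>2) \<le> s k / 4 * (12 / 10000)"
    using sj by linarith
  then have c2: "1 - ?c\<^sup>2 \<le> 12 / 10000"
    using s_simps(1)[of k] by (subst (asm) mult_le_cancel_left_pos) auto
  have "?c \<le> 1"
    using norm_cauchy_schwarz[of ?n ?n'] norm by simp
  then have "?c\<^sup>2 \<le> ?c"
    using pos mult_left_mono[of ?c 1 ?c] by (simp add: power2_eq_square)
  have "(norm (?n - ?n'))\<^sup>2 = 2 - 2 * ?c"
    using nn by (simp add: power2_norm_eq_inner inner_diff_left inner_diff_right inner_commute)
  \<comment> \<open>Since \<open>?c\<^sup>2 \<le> ?c\<close>, the left side is at most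
    \<open>24 / 10000\<close>, below \<open>25 / 10000\<close>.\<close>
  also have "\<dots> \<le> (1 / 20)\<^sup>2"
    using c2 \<open>?c\<^sup>2 \<le> ?c\<close> by (simp add: power2_eq_square)
  finally show ?thesis
    using power2_le_imp_le[of "norm (?n - ?n')" "1 / 20"] by simp
qed

lemma orient_Suc:
  assumes "p \<in> E"
  shows "norm (orient p k - orient p (Suc k)) \<le> 1 / 20"
proof (rule orient_close[OF assms assms])
  show "d p p \<le> s k / 4" using s_simps(1)[of k] by simp
  show "0 \<le> orient p k \<bullet> orient p (Suc k)" by (auto simp: inner_commute)
qed simp

lemma orient_base:
  assumes "p \<in> E" "d x p \<le> \<rho> / 4"
  shows "norm (nrm x 0 - orient p 0) \<le> 1 / 20"
  unfolding orient_x[symmetric]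
  using assms by (intro orient_close[OF x assms(1)]) (auto simp: s_simps inner_commute)

text \<open>Errors do not accumulate over the scales: passing through scale \<open>k\<close> gives
  only \<open>3 / 20\<close>, but this excludes opposite orientations, and
  \<open>orient_close\<close> then restores \<open>1 / 20\<close> from flatness at the new
  scale.\<close>

lemma orient_near:
  assumes p: "p \<in> E" "d x p \<le> \<rho> / 4" and q: "q \<in> E" "d x q \<le> \<rho> / 4" and "d p q \<le> s k / 4"
  shows "norm (orient p k - orient q k) \<le> 1 / 20"
  using assms(5)
proof (induction k)
  case 0
  have "norm (orient p 0 - orient q 0) \<le> 1 / 20 + 1 / 20"
    using norm_triangle_ineq4[of "nrm x 0 - orient q 0" "nrm x 0 - orient p 0"]
      orient_base[OF p] orient_base[OF q] by (simp add: algebra_simps)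
  then show ?case
    using 0 by (intro orient_close[OF p(1) q(1)] inner_nonneg_if_close norm_orient p q) auto
next
  case (Suc k)
  have "d p q \<le> s k / 4"
    using Suc.prems s_simps(1,2)[of k] by simp
  note IH = Suc.IH[OF this]
  let ?a = "orient p k" and ?b = "orient q k" and ?a' = "orient p (Suc k)" and ?b' = "orient q (Suc k)"
  have eq: "?a' - ?b' = (?a - ?b) - (?a - ?a') + (?b - ?b')" by (simp del: orient.simps)
  have "norm (?a' - ?b') \<le> norm (?a - ?b) + norm (?a - ?a') + norm (?b - ?b')"
    unfolding eq
    using norm_triangle_ineq[of "(?a - ?b) - (?a - ?a')" "?b - ?b'"] norm_triangle_ineq4[of "?a - ?b" "?a - ?a'"]
    by linarith
  also have "\<dots> \<le> 1 / 20 + 1 / 20 + 1 / 20"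
    by (intro add_mono IH orient_Suc p q)
  finally show ?case
    using Suc.prems by (intro orient_close[OF p(1) q(1)] inner_nonneg_if_close norm_orient p q)
      (auto simp del: orient.simps)
qed

text \<open>The distance from \<open>y\<close> to \<open>E\<close> lies between
  \<open>s k / 32\<close> and \<open>s k / 16\<close>, a scale as in a Whitney decomposition. There
  the height of \<open>y\<close> dominates the flatness error, so its sign tells the side of
  \<open>E\<close>.\<close>

definition paired :: "'a \<Rightarrow> 'a \<Rightarrow> nat \<Rightarrow> bool" where
  "paired y p k \<longleftrightarrow> p \<in> E \<and> d x p \<le> \<rho> / 4 \<and> d p y \<le> s k / 16 \<and> (\<forall>e\<in>E. s k / 32 \<le> d e y)"

definition height :: "'a \<Rightarrow> 'a \<Rightarrow> nat \<Rightarrow> real" where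
  "height y p k = y \<bullet> orient p k - p \<bullet> orient p k"

lemma paired_exists:
  assumes "y \<notin> E" "d x y \<le> \<rho> / 16"
  shows "\<exists>p k. paired y p k"
proof -
  obtain p where p: "p \<in> E" "\<And>e. e \<in> E \<Longrightarrow> d y p \<le> d y e"
    using continuous_attains_inf[OF compact, of "d y"] x continuous_on_subset[OF continuous_on_d]
    by (metis empty_iff subset_UNIV)
  let ?\<delta> = "d y p"
  have pos: "0 < ?\<delta>"
    using p(1) assms(1) metr.nonneg[of y p] metr.zero[of y p] by fastforce
  have le: "?\<delta> \<le> \<rho> / 16"
    using p(2)[OF x] assms(2) d_comm[of x y] by linarith
  obtain j where j: "s j < 16 * ?\<delta>"
  proof -
    obtain j where "(1 / 2) ^ j < 16 * ?\<delta> / \<rho>"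
      using real_arch_pow_inv[of "16 * ?\<delta> / \<rho>" "1 / 2"] pos \<rho> by auto
    then show thesis
      using \<rho> by (intro that[of j]) (simp add: s_def field_simps)
  qed
  \<comment> \<open>\<open>i\<close> is the first index with scale below
    \<open>16 * ?\<delta>\<close>; it is not \<open>0\<close> because
    \<open>16 * ?\<delta> \<le> \<rho>\<close>, and the wanted index is the one before it.\<close>
  define i where "i = (LEAST j. s j < 16 * ?\<delta>)"
  have i: "s i < 16 * ?\<delta>" unfolding i_def using j by (rule LeastI)
  then have "i \<noteq> 0" using le s_simps(3) by (cases i) auto
  then obtain k where k: "i = Suc k" using not0_implies_Suc by blast
  have "16 * ?\<delta> \<le> s k"
    using not_less_Least[of k "\<lambda>j. s j < 16 * ?\<delta>"] k unfolding i_def by auto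
  moreover have "s k < 32 * ?\<delta>" using i s_simps(2)[of k] by (simp add: k)
  moreover have "d x p \<le> \<rho> / 4"
    using d_tri[of x p y] assms(2) le \<rho> by linarith
  ultimately have "paired y p k"
    unfolding paired_def using p d_comm[of _ y]
    by (metis (no_types, opaque_lifting) divide_le_eq_numeral1(1) le_divide_eq_numeral1(1) less_eq_real_def mult.commute order_trans)
  then show ?thesis by blast
qed

text \<open>Undoing the height moves \<open>y\<close> by exactly that amount into the coset at
  \<open>p\<close>, where \<open>E\<close> is within \<open>s k / 10000\<close>; but
  \<open>y\<close> is at least \<open>s k / 32\<close> away from \<open>E\<close>.\<close>

lemma paired_height:
  assumes "paired y p k"
  shows "s k / 64 \<le> \<bar>height y p k\<bar>"
proof -
  let ?n = "orient p k"
  have p: "p \<in> E" "d p y \<le> s k / 16" "\<And>e. e \<in> E \<Longrightarrow> s k / 32 \<le> d e y"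
    using assms by (auto simp: paired_def)
  note n = orient_hor[OF p(1), of k] norm_orient[OF p(1), of k]
  have nn: "?n \<bullet> ?n = 1" using n by (simp add: dot_square_norm)
  define t where "t = height y p k"
  define z where "z = y \<odot> ((- t) *\<^sub>R ?n)"
  have yz: "d y z = \<bar>t\<bar>"
    using subspace_scale[OF hor_subspace n(1), of "- t"] n(2) unfolding z_def d_mult
    by (subst hnorm_hor) auto
  have "\<bar>t\<bar> \<le> d p y"
    using abs_inner_diff_le[OF n(1), of y p] n(2) by (simp add: t_def height_def)
  let ?v = "- p \<odot> z"
  have pz: "p \<odot> ?v = z" by (simp add: assoc[symmetric])
  have "?v \<bullet> ?n = 0"
    using nn by (simp add: z_def t_def height_def inner_mult[OF n(1)])
  moreover have "hnorm ?v \<le> s k"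
    using d_tri[of p z y] yz \<open>\<bar>t\<bar> \<le> d p y\<close> p(2) s_simps(1)[of k] by (simp add: hom_dist_def[of G p z, symmetric])
  ultimately obtain e where e: "e \<in> E" "d e z \<le> s k / 10000"
    using orient_full[OF p(1)] pz by metis
  have "s k / 32 \<le> s k / 10000 + \<bar>t\<bar>"
    using p(3)[OF e(1)] d_tri[of e y z] e(2) yz d_comm[of y z] by linarith
  then show ?thesis
    using s_simps(1)[of k] unfolding t_def by linarith
qed

text \<open>Nearby points are paired at scales differing by a factor of at most two, where the
  normals are close, so the height changes by less than its lower bound \<open>s k / 64\<close>.
  With \<open>y' = y\<close> this shows that the sign does not depend on the pair.\<close>

lemma height_sign:
  assumes 1: "paired y p k" and 2: "paired y' p' k'"
    and near: "d y y' \<le> s k / 1000" "d y y' \<le> s k' / 1000" and pos: "0 < height y p k"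
  shows "0 < height y' p' k'"
proof -
  let ?n = "orient p k" and ?n' = "orient p' k'"
  have p: "p \<in> E" "d x p \<le> \<rho> / 4" "d p y \<le> s k / 16" "\<And>e. e \<in> E \<Longrightarrow> s k / 32 \<le> d e y"
    using 1 by (auto simp: paired_def)
  have p': "p' \<in> E" "d x p' \<le> \<rho> / 4" "d p' y' \<le> s k' / 16" "\<And>e. e \<in> E \<Longrightarrow> s k' / 32 \<le> d e y'"
    using 2 by (auto simp: paired_def)
  have yy: "d y' y = d y y'" by (rule d_comm)
  \<comment> \<open>\<open>p'\<close> lies in \<open>E\<close>, so its distance to \<open>y\<close>
    is at least \<open>s k / 32\<close>, yet it is at most about \<open>s k' / 16\<close>. For
    dyadic scales a ratio below \<open>4\<close> is at most \<open>2\<close>.\<close>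
  have s_lt: "s k < 4 * s k'"
    using p(4)[OF p'(1)] d_tri[of p' y y'] p'(3) near s_simps(1)[of k'] yy by linarith
  have s'_lt: "s k' < 4 * s k"
    using p'(4)[OF p(1)] d_tri[of p y' y] p(3) near s_simps(1)[of k] yy by linarith
  have s_rec: "s (Suc (Suc j)) = s j / 4" for j by (simp add: s_simps)
  have mono: "s j \<le> s i" if "i \<le> j" for i j
    using \<rho> that by (simp add: s_def frac_le power_increasing)
  have "k' < Suc (Suc k)"
    using s_lt mono[of "Suc (Suc k)" k'] s_rec[of k] by linarith
  moreover have k_lt: "k < Suc (Suc k')"
    using s'_lt mono[of "Suc (Suc k')" k] s_rec[of k'] by linarith
  moreover have pp: "d p p' \<le> s k / 16 + s k / 1000 + s k' / 16"
    using d_tri[of p p' y] d_tri[of y p' y'] p(3) p'(3) near(1) d_comm[of p' y'] by linarith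
  ultimately consider "k' = k" | "k' = Suc k" | "k = Suc k'" by linarith
  then have close: "s k' \<le> 2 * s k \<and> norm (?n' - ?n) \<le> 1 / 20 + 1 / 20"
  proof cases
    case 1
    have "norm (orient p k - orient p' k) \<le> 1 / 20"
      using pp s_simps(1)[of k] unfolding 1 by (intro orient_near p p') linarith
    then show ?thesis
      using s_simps(1)[of k] unfolding 1 by (simp add: norm_minus_commute)
  next
    case 2
    have "norm (orient p k - orient p' k) \<le> 1 / 20"
      using pp s_simps(1,2)[of k] unfolding 2 by (intro orient_near p p') linarith
    then have "norm (orient p' (Suc k) - orient p k) \<le> 1 / 20 + 1 / 20"
      using orient_Suc[OF p'(1), of k]
      by (intro norm_diff_triangle_le[of _ "orient p' k"]) (simp_all only: norm_minus_commute)
    then show ?thesis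
      using s_simps(1,2)[of k] unfolding 2 by linarith
  next
    case 3
    have "norm (orient p k' - orient p' k') \<le> 1 / 20"
      using pp near(2) s_simps(1,2)[of k'] unfolding 3 by (intro orient_near p p') linarith
    then have "norm (orient p' k' - orient p (Suc k')) \<le> 1 / 20 + 1 / 20"
      using orient_Suc[OF p(1), of k']
      by (intro norm_diff_triangle_le[of _ "orient p k'"]) (simp_all only: norm_minus_commute)
    then show ?thesis
      using s_simps(1,2)[of k'] unfolding 3 by linarith
  qed
  note n = orient_hor[OF p(1), of k] norm_orient[OF p(1), of k]
  have n': "?n' - ?n \<in> hor"
    using n orient_hor[OF p'(1), of k'] hor_subspace by (intro subspace_diff)
  have "\<bar>y' \<bullet> ?n - y \<bullet> ?n\<bar> \<le> s k / 1000"
    using abs_inner_diff_le[OF n(1), of y' y] n(2) near(1) by simp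
  moreover have "\<bar>p' \<bullet> ?n - p \<bullet> ?n\<bar> \<le> s k / 10000"
    using pp close s_simps(1)[of k] by (intro orient_flat p p') linarith
  moreover have "\<bar>y' \<bullet> (?n' - ?n) - p' \<bullet> (?n' - ?n)\<bar> \<le> s k / 80"
  proof -
    have "d p' y' * norm (?n' - ?n) \<le> (s k / 8) * (1 / 10)"
      using p'(3) close s_simps(1)[of k] by (intro mult_mono) auto
    then show ?thesis
      using abs_inner_diff_le[OF n', of y' p'] by simp
  qed
  moreover have "s k / 64 \<le> y \<bullet> ?n - p \<bullet> ?n"
    using paired_height[OF 1] pos by (simp add: height_def)
  \<comment> \<open>The errors \<open>s k / 1000\<close>, \<open>s k / 10000\<close> and
    \<open>s k / 80\<close> add up to less than \<open>s k / 64\<close>.\<close>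
  ultimately show ?thesis
    using s_simps(1)[of k] unfolding height_def inner_diff_right by linarith
qed

text \<open>Far from the plane at \<open>x\<close> the paired scale is one of the two largest, where
  the oriented normal is within \<open>1 / 10\<close> of the normal at \<open>x\<close>. This
  identifies the sides of the two ends of a vertical segment.\<close>

lemma height_sign_far:
  assumes "paired y p k" and "\<rho> / 32 \<le> \<bar>y \<bullet> nrm x 0 - x \<bullet> nrm x 0\<bar>"
  shows "0 < height y p k \<longleftrightarrow> 0 < y \<bullet> nrm x 0 - x \<bullet> nrm x 0"
proof -
  let ?n = "orient p k" and ?N = "nrm x 0"
  have p: "p \<in> E" "d x p \<le> \<rho> / 4" "d p y \<le> s k / 16" using assms by (auto simp: paired_def)
  note N = plane_normal_hor[OF plane_P[OF x], of 0] norm_plane_normal[OF plane_P[OF x], of 0]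
  have pN: "\<bar>p \<bullet> ?N - x \<bullet> ?N\<bar> \<le> \<rho> / 10000"
    using orient_flat[OF x p(1), of 0] p(2) \<rho> unfolding orient_x s_simps(3) by linarith
  have "\<bar>y \<bullet> ?N - p \<bullet> ?N\<bar> \<le> s k / 16"
    using abs_inner_diff_le[OF N(1), of y p] N(2) p(3) by simp
  then have "\<rho> / 4 < s k"
    using assms(2) pN \<rho> by linarith
  have "k < 2"
  proof (rule ccontr)
    assume "\<not> k < 2"
    then have "(2::real) ^ 2 \<le> 2 ^ k" by (intro power_increasing) auto
    then have "s k \<le> \<rho> / 4"
      using \<rho> divide_left_mono[of "2 ^ 2" "2 ^ k" \<rho>] by (simp add: s_def)
    with \<open>\<rho> / 4 < s k\<close> show False by simp
  qed
  then have "k = 0 \<or> k = Suc 0" by linarith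
  then have close: "norm (?N - ?n) \<le> 1 / 20 + 1 / 20"
  proof
    assume "k = 0"
    then show ?thesis using orient_base[OF p(1,2)] by simp
  next
    assume "k = Suc 0"
    then show ?thesis
      using norm_diff_triangle_le[OF orient_base[OF p(1,2)] orient_Suc[OF p(1), of 0]] by simp
  qed
  have "s k \<le> \<rho>" using \<rho> divide_left_mono[of 1 "2 ^ k" \<rho>] by (simp add: s_def)
  have n': "?N - ?n \<in> hor"
    using N orient_hor[OF p(1), of k] hor_subspace by (intro subspace_diff)
  have "d p y * norm (?N - ?n) \<le> (\<rho> / 16) * (1 / 10)"
    using p(3) close \<open>s k \<le> \<rho>\<close> \<rho> by (intro mult_mono) auto
  then have "\<bar>y \<bullet> (?N - ?n) - p \<bullet> (?N - ?n)\<bar> \<le> \<rho> / 160"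
    using abs_inner_diff_le[OF n', of y p] by simp
  then show ?thesis
    using assms(2) pN \<rho> unfolding height_def inner_diff_right by linarith
qed

text \<open>The sign of the height is locally constant off \<open>E\<close> and differs at the two ends of the segment.\<close>

lemma vertical_segment_meets:
  assumes w: "w \<in> P x 0" "hnorm w \<le> \<rho> / 32"
  shows "\<exists>t. \<bar>t\<bar> \<le> \<rho> / 32 \<and> x \<odot> w \<odot> (t *\<^sub>R nrm x 0) \<in> E"
proof (rule ccontr)
  assume none: "\<not> ?thesis"
  let ?N = "nrm x 0"
  define y where "y t = x \<odot> w \<odot> (t *\<^sub>R ?N)" for t
  define T where "T = \<rho> / 32"
  define pos where "pos t \<longleftrightarrow> (\<exists>p k. paired (y t) p k \<and> 0 < height (y t) p k)" for t
  note N = plane_normal_hor[OF plane_P[OF x], of 0] norm_plane_normal[OF plane_P[OF x], of 0]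
  have hnorm_N: "hnorm (t *\<^sub>R ?N) = \<bar>t\<bar>" for t
    using subspace_scale[OF hor_subspace N(1)] N(2) by (subst hnorm_hor) auto
  have dy: "d (y t) (y t') = \<bar>t' - t\<bar>" for t t'
  proof -
    have "y t' = y t \<odot> ((t' - t) *\<^sub>R ?N)"
      unfolding y_def assoc mult_scaleR by simp
    then show ?thesis by (simp add: d_mult hnorm_N)
  qed
  have y_N: "y t \<bullet> ?N - x \<bullet> ?N = t" for t
    using w(1) N(2) plane_iff[OF plane_P[OF x]] by (simp add: y_def inner_mult[OF N(1)] dot_square_norm)
  have pairs: "\<exists>p k. paired (y t) p k" if "t \<in> {-T..T}" for t
  proof (rule paired_exists)
    show "y t \<notin> E" using none that by (auto simp: y_def T_def)
    have "d x (y t) \<le> hnorm w + \<bar>t\<bar>"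
      using d_mult[of x "w \<odot> (t *\<^sub>R ?N)"] hnorm_mult[of w "t *\<^sub>R ?N"] by (simp add: y_def assoc hnorm_N)
    then show "d x (y t) \<le> \<rho> / 16" using w(2) that by (auto simp: T_def)
  qed
  have T: "0 < T" using \<rho> by (simp add: T_def)
  \<comment> \<open>The positive side at \<open>T\<close> propagates along the connected interval to
    \<open>- T\<close>, where the height is in fact negative.\<close>
  have "pos (- T)"
  proof (rule connected_induction_simple[of "{-T..T}" T])
    obtain p k where pk: "paired (y T) p k" using pairs[of T] T by auto
    then have "0 < height (y T) p k"
      using height_sign_far[OF pk] y_N[of T] T by (simp add: T_def)
    with pk show "pos T" unfolding pos_def by blast
    fix t assume t: "t \<in> {-T..T}"
    obtain p k where pk: "paired (y t) p k" using pairs[OF t] by blast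
    \<comment> \<open>Two points of this neighbourhood are within \<open>s k / 2500\<close>, and by
      \<open>big\<close> their paired scales are at least \<open>496 / 1000 * s k\<close>, so
      \<open>height_sign\<close> applies.\<close>
    let ?U = "{-T..T} \<inter> ball t (s k / 5000)"
    have big: "496 / 1000 * s k \<le> s k1" if "paired (y t1) p1 k1" "t1 \<in> ?U" for t1 p1 k1
    proof -
      have "s k / 32 \<le> d p1 (y t)" "d p1 (y t1) \<le> s k1 / 16"
        using pk that by (auto simp: paired_def)
      moreover have "d (y t1) (y t) \<le> s k / 5000"
        using that(2) by (simp add: dy dist_real_def)
      ultimately show ?thesis
        using d_tri[of p1 "y t" "y t1"] s_simps(1)[of k] by linarith
    qed
    have "pos t2" if t12: "t1 \<in> ?U" "t2 \<in> ?U" "pos t1" for t1 t2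
    proof -
      obtain p1 k1 where 1: "paired (y t1) p1 k1" "0 < height (y t1) p1 k1"
        using t12(3) by (auto simp: pos_def)
      obtain p2 k2 where 2: "paired (y t2) p2 k2" using pairs[of t2] t12 by blast
      have "\<bar>t - t1\<bar> < s k / 5000" "\<bar>t - t2\<bar> < s k / 5000"
        using t12(1,2) by (auto simp: dist_real_def)
      then have near: "d (y t1) (y t2) \<le> s k / 2500"
        unfolding dy by linarith
      have "0 < height (y t2) p2 k2"
        using near big[OF 1(1) t12(1)] big[OF 2 t12(2)] s_simps(1)[of k]
        by (intro height_sign[OF 1(1) 2 _ _ 1(2)]) linarith+
      with 2 show ?thesis unfolding pos_def by blast
    qed
    moreover have "openin (top_of_set {-T..T}) ?U" by (intro openin_open_Int) simp
    moreover have "t \<in> ?U" using t s_simps(1)[of k] by simp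
    ultimately show "\<exists>U. openin (top_of_set {-T..T}) U \<and> t \<in> U \<and> (\<forall>t1\<in>U. \<forall>t2\<in>U. pos t1 \<longrightarrow> pos t2)"
      by blast
  qed (use T in auto)
  then obtain p k where pk: "paired (y (- T)) p k" "0 < height (y (- T)) p k"
    unfolding pos_def by blast
  then show False
    using height_sign_far[OF pk(1)] y_N[of "- T"] T by (simp add: T_def)
qed

end


section \<open>Big projections\<close>

context flat_family
begin

text \<open>The projection forgets the position \<open>t\<close> on the normal line: the point of
  \<open>E\<close> over \<open>w\<close> goes to \<open>x \<odot> w \<odot> - h\<close>, the
  translate by \<open>x \<odot> - h\<close> of a conjugate of \<open>w\<close>. The constant is
  \<open>768 = 32 * 24\<close>, from the radius \<open>\<rho> / 32\<close> and the bound for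
  conjugated balls.\<close>

lemma projection_ge:
  assumes "regular_plane m (P x 0)"
  shows "ennreal ((\<rho> / 768) ^ m) \<le> haus m (splitting_projection G (P x 0) ` (E \<inter> hball G x \<rho>))"
proof -
  let ?V = "P x 0" and ?N = "nrm x 0"
  define h where "h = (x \<bullet> ?N) *\<^sub>R ?N"
  let ?D = "(\<lambda>w. h \<odot> w \<odot> - h) ` (?V \<inter> hcball G 0 (\<rho> / 32))"
  note V = plane_P[OF x, of 0]
  note N = plane_normal_hor[OF V] norm_plane_normal[OF V]
  have "(\<odot>) (x \<odot> - h) ` ?D \<subseteq> splitting_projection G ?V ` (E \<inter> hball G x \<rho>)"
  proof clarify
    fix w assume w: "w \<in> ?V" "w \<in> hcball G 0 (\<rho> / 32)"
    then obtain t where t: "\<bar>t\<bar> \<le> \<rho> / 32" "x \<odot> w \<odot> (t *\<^sub>R ?N) \<in> E"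
      using vertical_segment_meets[of w] by (auto simp: d_0)
    let ?g = "x \<odot> w \<odot> (t *\<^sub>R ?N)"
    have "hnorm (t *\<^sub>R ?N) = \<bar>t\<bar>"
      using subspace_scale[OF hor_subspace N(1)] N(2) by (subst hnorm_hor) auto
    then have "d x ?g \<le> \<rho> / 32 + \<rho> / 32"
      using d_mult[of x "w \<odot> (t *\<^sub>R ?N)"] hnorm_mult[of w "t *\<^sub>R ?N"] w(2) t(1)
      by (simp add: assoc d_0)
    then have "?g \<in> E \<inter> hball G x \<rho>"
      using t(2) \<rho> by simp
    moreover have "splitting_projection G ?V ?g = x \<odot> - h \<odot> (h \<odot> w \<odot> - h)"
    proof -
      have "?g \<bullet> ?N = x \<bullet> ?N + t"
        using w(1) N(2) by (simp add: inner_mult[OF N(1)] plane_iff[OF V] dot_square_norm)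
      then have "splitting_projection G ?V ?g = x \<odot> w \<odot> ((t + - (x \<bullet> ?N + t)) *\<^sub>R ?N)"
        unfolding splitting_projection_eq[OF V] by (simp only: assoc mult_scaleR)
      also have "\<dots> = x \<odot> w \<odot> - h"
        by (simp add: h_def)
      also have "\<dots> = x \<odot> - h \<odot> (h \<odot> w \<odot> - h)"
        by (metis assoc left_inverse group_left_neutral)
      finally show ?thesis .
    qed
    ultimately show "x \<odot> - h \<odot> (h \<odot> w \<odot> - h) \<in> splitting_projection G ?V ` (E \<inter> hball G x \<rho>)"
      by (metis imageI)
  qed
  then have "haus m ?D \<le> haus m (splitting_projection G ?V ` (E \<inter> hball G x \<rho>))"
    using hausdorff_mono hausdorff_left[of m "x \<odot> - h" ?D] by metis
  moreover have "ennreal ((\<rho> / 32 / 24) ^ m) \<le> haus m ?D"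
    using \<rho> by (intro hausdorff_conjugated_ball_ge assms) simp
  ultimately show ?thesis by simp
qed

end

theorem theorem6:
  fixes G :: "('a::euclidean_space) carnot" and E :: "'a set"
  assumes "carnot_group G"
    and "compact E"
    and "0 < hdiam G E"
    and "\<exists>\<eta>\<^sub>1::nat. 0 < \<eta>\<^sub>1 \<and>
      (\<forall>x\<in>E. \<forall>r::real. 0 < r \<and> ennreal r < hdiam G E \<longrightarrow>
         ennreal (inverse (real \<eta>\<^sub>1) * r ^ (hom_dim G - 1))
           \<le> hausdorff_outer G (hom_dim G - 1) (E \<inter> hball G x r) \<and>
         hausdorff_outer G (hom_dim G - 1) (E \<inter> hball G x r)
           \<le> ennreal (real \<eta>\<^sub>1 * r ^ (hom_dim G - 1)))"
    and "\<forall>e::real>0. \<forall>\<^sub>F r in at_right 0. \<forall>x\<in>E.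
      flat_distance G x r (measure_restriction (hausdorff_measure G (hom_dim G - 1)) E) < ennreal e"
  shows "\<exists>\<eta>\<^sub>2::nat. 0 < \<eta>\<^sub>2 \<and>
    (AE x in hausdorff_measure G (hom_dim G - 1). x \<in> E \<longrightarrow>
       (\<forall>\<^sub>F \<rho> in at_right (0::real). \<exists>W\<in>Gr G.
          ennreal (inverse (real \<eta>\<^sub>2) * \<rho> ^ (hom_dim G - 1))
            \<le> hausdorff_outer G (hom_dim G - 1) (splitting_projection G W ` (E \<inter> hball G x \<rho>))))"
proof (intro exI[of _ "768 ^ (hom_dim G - 1)"] conjI)
  interpret carnot_grp G by unfold_locales (rule assms(1))
  let ?Q = "hom_dim G"
  define m where "m = ?Q - 1"
  let ?M = "hausdorff_measure G m"
  show "AE x in hausdorff_measure G (?Q - 1). x \<in> E \<longrightarrow>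
       (\<forall>\<^sub>F \<rho> in at_right (0::real). \<exists>W\<in>Gr G.
          ennreal (inverse (real (768 ^ (?Q - 1))) * \<rho> ^ (?Q - 1))
            \<le> haus (?Q - 1) (splitting_projection G W ` (E \<inter> hball G x \<rho>)))"
    unfolding m_def[symmetric]
  proof (cases "emeasure ?M UNIV = 0")
    \<comment> \<open>This case also covers the junk value of \<open>measure_of\<close> (the null measure), so it need not be shown
      that \<open>hausdorff_outer\<close> is countably additive on the Borel sets.\<close>
    case True
    then show "AE x in ?M. x \<in> E \<longrightarrow>
       (\<forall>\<^sub>F \<rho> in at_right (0::real). \<exists>W\<in>Gr G.
          ennreal (inverse (real (768 ^ m)) * \<rho> ^ m)
            \<le> haus m (splitting_projection G W ` (E \<inter> hball G x \<rho>)))"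
      by (intro AE_I[of _ _ UNIV]) auto
  next
    case False
    obtain \<eta> :: nat where \<eta>: "0 < \<eta>"
      "\<And>x r. \<lbrakk>x \<in> E; 0 < r; ennreal r < hdiam G E\<rbrakk> \<Longrightarrow>
         ennreal (1 / real \<eta> * r ^ m) \<le> haus m (E \<inter> hball G x r)"
      "\<And>x r. \<lbrakk>x \<in> E; 0 < r; ennreal r < hdiam G E\<rbrakk> \<Longrightarrow>
         haus m (E \<inter> hball G x r) \<le> ennreal (real \<eta> * r ^ m)"
      using assms(4) unfolding m_def by (auto simp: inverse_eq_divide)
    obtain r1 where r1: "0 < r1" "ennreal r1 < hdiam G E"
    proof -
      obtain z where z: "0 < z" "z < hdiam G E" using dense[OF assms(3)] by blast
      then have "z < top" using less_trans[OF z(2)] top_greatest le_less_trans by (metis not_less top_unique)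
      then show thesis
        using z that[of "enn2real z"] by (auto simp: enn2real_positive_iff)
    qed
    have small: "ennreal r < hdiam G E" if "r < r1" for r
      using r1 that by (metis ennreal_leI less_imp_le le_less_trans)
    let ?\<epsilon> = "1 / 10000 :: real"
    define \<delta> where "\<delta> = 1 / real \<eta> * (?\<epsilon> / 4) ^ ?Q / 2 ^ (?Q + 1)"
    have "0 < \<delta>" using \<eta>(1) by (simp add: \<delta>_def)
    then have "\<forall>\<^sub>F r in at_right 0. \<forall>x\<in>E. flat_distance G x r (measure_restriction ?M E) < ennreal \<delta>"
      using assms(5) unfolding m_def by blast
    then obtain b where b: "0 < b"
      "\<And>r x. \<lbrakk>0 < r; r < b; x \<in> E\<rbrakk> \<Longrightarrow> flat_distance G x r (measure_restriction ?M E) < ennreal \<delta>"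
      unfolding eventually_at_right_field by blast
    have flat: "\<exists>V. regular_plane m V \<and> flat_at E ?\<epsilon> x r V"
      if "x \<in> E" "0 < r" "2 * r < b" "2 * r < r1" for x r
      unfolding m_def
    proof (rule flat_distance_imp_flat_at[where \<eta> = \<eta> and R = r1 and A = UNIV])
      show "flat_distance G x (2 * r) (measure_restriction (hausdorff_measure G (?Q - 1)) E)
          < ennreal (1 / real \<eta> * (?\<epsilon> / 4) ^ ?Q / 2 ^ (?Q + 1))"
        using b(2)[of "2 * r" x] that unfolding \<delta>_def m_def by simp
      show "E \<in> sets borel" using assms(2) by (simp add: compact_imp_closed)
    qed (use False \<eta> small that in \<open>auto simp: m_def\<close>)
    show "AE x in ?M. x \<in> E \<longrightarrow>
       (\<forall>\<^sub>F \<rho> in at_right (0::real). \<exists>W\<in>Gr G.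
          ennreal (inverse (real (768 ^ m)) * \<rho> ^ m)
            \<le> haus m (splitting_projection G W ` (E \<inter> hball G x \<rho>)))"
    proof (intro AE_I2 impI)
      fix x assume x: "x \<in> E"
      \<comment> \<open>The range of \<open>\<rho>\<close> is halved since flatness at scale
        \<open>r\<close> is read off from the flat distance at \<open>2 * r\<close>.\<close>
      have "\<exists>W\<in>Gr G. ennreal (inverse (real (768 ^ m)) * \<rho> ^ m)
            \<le> haus m (splitting_projection G W ` (E \<inter> hball G x \<rho>))"
        if \<rho>: "0 < \<rho>" "\<rho> < min b r1 / 2" for \<rho>
      proof -
        have "\<exists>V. regular_plane m V \<and> flat_at E ?\<epsilon> p (\<rho> / 2 ^ k) V" if "p \<in> E" for p and k :: nat
        proof (rule flat[OF that])
          have "\<rho> / 2 ^ k \<le> \<rho>"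
            using \<rho>(1) divide_left_mono[of 1 "2 ^ k" \<rho>] by simp
          then show "2 * (\<rho> / 2 ^ k) < b" "2 * (\<rho> / 2 ^ k) < r1"
            using \<rho>(2) by linarith+
        qed (use \<rho> in simp)
        \<comment> \<open>One choice of planes for all points of \<open>E\<close> and all scales;
          the plane at \<open>x\<close> with index \<open>0\<close> becomes
          \<open>W\<close>.\<close>
        then obtain P where P: "\<And>p k. p \<in> E \<Longrightarrow> regular_plane m (P p k)"
          "\<And>p k. p \<in> E \<Longrightarrow> flat_at E ?\<epsilon> p (\<rho> / 2 ^ k) (P p k)"
          by metis
        interpret flat_family G E x \<rho> P
          by unfold_locales (use assms(2) x \<rho> P in auto)
        have "inverse (real (768 ^ m)) * \<rho> ^ m = (\<rho> / 768) ^ m"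
          by (simp add: power_divide inverse_eq_divide)
        then show ?thesis
          using projection_ge[OF P(1)[OF x]] plane_P[OF x] by metis
      qed
      moreover have "0 < min b r1 / 2" using b(1) r1(1) by simp
      ultimately show "\<forall>\<^sub>F \<rho> in at_right (0::real). \<exists>W\<in>Gr G.
          ennreal (inverse (real (768 ^ m)) * \<rho> ^ m)
            \<le> haus m (splitting_projection G W ` (E \<inter> hball G x \<rho>))"
        unfolding eventually_at_right_field by blast
    qed
  qed
qed simp

end
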